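(* Let $\mathcal M$ be a finite set of matrices (not assumed to be of the same size), let $\Omega$ be the (assumed nonempty) set of sequences $M=(M(n))_{n\ge1}$ in $\mathcal M$ such that the product $M(n+1)M(n)$ is defined for every $n$, let $S$ be the shift on $\Omega$, $(SM)(n)=M(n+1)$, and let $\nu$ be an $S$-invariant ergodic Borel probability measure on $\Omega$. For every $M\in\Omega$ let $(X_M,T)$ be a linearly recurrent Cantor system associated to the sequence $M$, and let $\mu_M$ be its unique invariant probability measure. Suppose that $(\Omega,S,\nu)$ is hyperbolic, i.e. there is a measurable set $B\subset\Omega$, invariant under $S$ and with $\nu(B)=1$, such that for every $M\in B$ and every $v\in\mathbb R^k$ the limit $$\lim_{n\to+\infty}\frac1n\log\|A(S^{n-1}M)\circ\cdots\circ A(SM)\circ A(M)(v)\|$$ exists in $\mathbb R\cup\{\pm\infty\}$ and is non-zero, where $k$ and $A$ are as defined in the context. Then for every $M\in B$, and thus for $\nu$-almost every $M\in\Omega$, every eigenfunction of $(X_M,T,\mu_M)$ is continuous.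
   Context: $k$ is the maximum size (number of rows or columns) of the elements of $\mathcal M$; by completing each element of $\mathcal M$ with zero entries, it is regarded as a $k\times k$ matrix. $A$ is the map from $\Omega$ to the linear maps of $\mathbb R^k$ sending $M$ to $M(2)$. $\|\cdot\|$ is any norm on $\mathbb R^k$. $\Omega$ carries the topology induced by the product topology. $S$-invariance of $B$ means $S(B)\subset B$. Convention $\log 0=-\infty$. A Cantor system $(X,T)$ is a Cantor space $X$ together with a homeomorphism $T:X\to X$; it is minimal if the only closed $T$-invariant subsets are $\emptyset$ and $X$. $\mathbb N=\{0,1,2,\dots\}$. A clopen Kakutani-Rokhlin (CKR) partition of $X$ is a partition of $X$ of the form $\{T^{-j}B_k : 1\le k\le C,\ 0\le j<h_k\}$, where $C\ge 1$, $B_1,\dots,B_C$ are (nonempty) clopen subsets of $X$ and $h_1,\dots,h_C$ are positive integers; its base is $\bigcup_k B_k$. Consider a sequence of CKR partitions $\mathcal P(n)=\{T^{-j}B_k(n):1\le k\le C(n),\ 0\le j<h_k(n)\}$, $n\in\mathbb N$, with bases $B(n)$, where $\mathcal P(0)$ is trivial: $B(0)=X$, $C(0)=1$, $h_1(0)=1$. Properties: (KR1) $B(n+1)\subset B(n)$ for all $n\ge 0$; (KR2) for all $n\ge 0$ every element of $\mathcal P(n+1)$ is contained in an element of $\mathcal P(n)$; (KR3) $\bigcap_{n} B(n)$ is a single point; (KR4) the sequence of partitions spans the topology of $X$; (KR5) for all $n\ge1$, $1\le k\le C(n-1)$, $1\le l\le C(n)$ there is $0\le j<h_l(n)$ with $T^{-j}B_l(n)\subset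 B_k(n-1)$; (KR6) $B(n+1)\subset B_1(n)$ for all $n\in\mathbb N$; (LR) there is $L$ such that $h_l(n)\le L\,h_k(n-1)$ for all $n\ge1$, $1\le l\le C(n)$, $1\le k\le C(n-1)$. A minimal Cantor system is linearly recurrent if it has such a sequence satisfying (KR1)-(KR6) and (LR). Such systems are uniquely ergodic. The matrices associated to the sequence of partitions are the $C(n)\times C(n-1)$ matrices, $n\ge1$, with entries $m_{l,k}(n)=\#\{0\le j<h_l(n):T^{-j}B_l(n)\subset B_k(n-1)\}$. "$(X_M,T)$ is associated to $M$" means that it has a sequence of CKR partitions satisfying (KR1)-(KR6) and (LR) whose associated $n$-th matrix is $M(n)$ for every $n\ge2$ (the first associated matrix, which is the column vector $(h_1(1),\dots,h_{C(1)}(1))^t$, is not constrained by $M$). An eigenfunction of $(X,T,\mu)$ is a nonzero $f\in L^2(\mu)$ with $f\circ T=\lambda f$ $\mu$-a.e. for some $\lambda\in\mathbb C$; it is called continuous if it coincides $\mu$-a.e. with a continuous function satisfying the same equation everywhere. *)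

theory Defs
  imports "HOL-Probability.Probability" "Jordan_Normal_Form.Matrix"
begin

section \<open>Cantor systems\<close>

definition cantor_space :: "'x topology \<Rightarrow> bool" where
  "cantor_space X \<longleftrightarrow>
     X homeomorphic_space product_topology (\<lambda>_::nat. discrete_topology (UNIV :: bool set)) UNIV"

definition minimal_cantor_system :: "'x topology \<Rightarrow> ('x \<Rightarrow> 'x) \<Rightarrow> bool" where
  "minimal_cantor_system X T \<longleftrightarrow>
     cantor_space X \<and> homeomorphic_map X X T \<and>
     (\<forall>F. closedin X F \<and> T ` F \<subseteq> F \<longrightarrow> F = {} \<or> F = topspace X)"

section \<open>Clopen Kakutani-Rokhlin partitions\<close>

text \<open>As \<open>T\<close> is a bijection of \<open>topspace X\<close>, the set \<open>T\<^sup>-\<^sup>jB\<close> is written as a preimage under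
  the iterate \<open>T\<^sup>j\<close>.\<close>

definition level :: "'x topology \<Rightarrow> ('x \<Rightarrow> 'x) \<Rightarrow> nat \<Rightarrow> 'x set \<Rightarrow> 'x set" where
  "level X T j B = {x \<in> topspace X. (T ^^ j) x \<in> B}"

definition tower_indices :: "nat \<Rightarrow> (nat \<Rightarrow> nat) \<Rightarrow> (nat \<times> nat) set" where
  "tower_indices c h = (SIGMA k:{1..c}. {..<h k})"

definition tower_partition ::
  "'x topology \<Rightarrow> ('x \<Rightarrow> 'x) \<Rightarrow> nat \<Rightarrow> (nat \<Rightarrow> 'x set) \<Rightarrow> (nat \<Rightarrow> nat) \<Rightarrow> 'x set set" where
  "tower_partition X T c B h = (\<lambda>(k, j). level X T j (B k)) ` tower_indices c h"

definition CKR_partition ::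
  "'x topology \<Rightarrow> ('x \<Rightarrow> 'x) \<Rightarrow> nat \<Rightarrow> (nat \<Rightarrow> 'x set) \<Rightarrow> (nat \<Rightarrow> nat) \<Rightarrow> bool" where
  "CKR_partition X T c B h \<longleftrightarrow>
     1 \<le> c \<and>
     (\<forall>k\<in>{1..c}. B k \<noteq> {} \<and> openin X (B k) \<and> closedin X (B k) \<and> 0 < h k) \<and>
     disjoint_family_on (\<lambda>(k, j). level X T j (B k)) (tower_indices c h) \<and>
     \<Union> (tower_partition X T c B h) = topspace X"

definition tower_base :: "nat \<Rightarrow> (nat \<Rightarrow> 'x set) \<Rightarrow> 'x set" where
  "tower_base c B = (\<Union>k\<in>{1..c}. B k)"

text \<open>The \<open>n\<close>-th partition has \<open>C n\<close> towers; the tower with index \<open>k \<in> {1..C n}\<close> has base \<open>B n k\<close>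
  and height \<open>h n k\<close>. The conjuncts after the first two are (KR1)-(KR6) and (LR), in this order.\<close>

definition LR_partition_sequence ::
  "'x topology \<Rightarrow> ('x \<Rightarrow> 'x) \<Rightarrow> (nat \<Rightarrow> nat) \<Rightarrow> (nat \<Rightarrow> nat \<Rightarrow> 'x set) \<Rightarrow> (nat \<Rightarrow> nat \<Rightarrow> nat) \<Rightarrow> bool"
where
  "LR_partition_sequence X T C B h \<longleftrightarrow>
     (\<forall>n. CKR_partition X T (C n) (B n) (h n)) \<and>
     (C 0 = 1 \<and> B 0 1 = topspace X \<and> h 0 1 = 1) \<and>
     (\<forall>n. tower_base (C (n+1)) (B (n+1)) \<subseteq> tower_base (C n) (B n)) \<and>
     (\<forall>n. \<forall>P \<in> tower_partition X T (C (n+1)) (B (n+1)) (h (n+1)).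
        \<exists>Q \<in> tower_partition X T (C n) (B n) (h n). P \<subseteq> Q) \<and>
     (\<exists>x. (\<Inter>n. tower_base (C n) (B n)) = {x}) \<and>
     X = topology_generated_by (\<Union>n. tower_partition X T (C n) (B n) (h n)) \<and>
     (\<forall>n\<ge>1. \<forall>k\<in>{1..C (n-1)}. \<forall>l\<in>{1..C n}.
        \<exists>j<h n l. level X T j (B n l) \<subseteq> B (n-1) k) \<and>
     (\<forall>n. tower_base (C (n+1)) (B (n+1)) \<subseteq> B n 1) \<and>
     (\<exists>L::real. \<forall>n\<ge>1. \<forall>l\<in>{1..C n}. \<forall>k\<in>{1..C (n-1)}.
        real (h n l) \<le> L * real (h (n-1) k))"

text \<open>Rows and columns of a \<open>mat\<close> are counted from 0, towers from 1.\<close>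

definition assoc_matrix ::
  "'x topology \<Rightarrow> ('x \<Rightarrow> 'x) \<Rightarrow> (nat \<Rightarrow> nat) \<Rightarrow> (nat \<Rightarrow> nat \<Rightarrow> 'x set) \<Rightarrow> (nat \<Rightarrow> nat \<Rightarrow> nat) \<Rightarrow> nat
    \<Rightarrow> real mat" where
  "assoc_matrix X T C B h n = mat (C n) (C (n-1))
     (\<lambda>(l, k). real (card {j. j < h n (l+1) \<and> level X T j (B n (l+1)) \<subseteq> B (n-1) (k+1)}))"

definition LR_system_associated ::
  "(nat \<Rightarrow> real mat) \<Rightarrow> 'x topology \<Rightarrow> ('x \<Rightarrow> 'x) \<Rightarrow> bool" where
  "LR_system_associated M X T \<longleftrightarrow>
     minimal_cantor_system X T \<and>
     (\<exists>C B h. LR_partition_sequence X T C B h \<and> (\<forall>n\<ge>2. assoc_matrix X T C B h n = M n))"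

section \<open>Invariant measures and eigenfunctions\<close>

definition borel_prob_on :: "'a topology \<Rightarrow> 'a measure \<Rightarrow> bool" where
  "borel_prob_on X \<mu> \<longleftrightarrow>
     prob_space \<mu> \<and> sets \<mu> = sets (sigma (topspace X) {U. openin X U})"

definition invariant_measure :: "'a measure \<Rightarrow> ('a \<Rightarrow> 'a) \<Rightarrow> bool" where
  "invariant_measure \<mu> T \<longleftrightarrow> T \<in> measurable \<mu> \<mu> \<and> distr \<mu> \<mu> T = \<mu>"

definition ergodic_measure :: "'a measure \<Rightarrow> ('a \<Rightarrow> 'a) \<Rightarrow> bool" where
  "ergodic_measure \<mu> T \<longleftrightarrow>
     invariant_measure \<mu> T \<and>
     (\<forall>E\<in>sets \<mu>. T -` E \<inter> space \<mu> = E \<longrightarrow> measure \<mu> E = 0 \<or> measure \<mu> E = 1)"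

definition eigenfunction ::
  "('x \<Rightarrow> 'x) \<Rightarrow> 'x measure \<Rightarrow> complex \<Rightarrow> ('x \<Rightarrow> complex) \<Rightarrow> bool" where
  "eigenfunction T \<mu> c f \<longleftrightarrow>
     f \<in> borel_measurable \<mu> \<and> integrable \<mu> (\<lambda>x. (cmod (f x))\<^sup>2) \<and>
     \<not> (AE x in \<mu>. f x = 0) \<and> (AE x in \<mu>. f (T x) = c * f x)"

definition ae_continuous_eigenfunction ::
  "'x topology \<Rightarrow> ('x \<Rightarrow> 'x) \<Rightarrow> 'x measure \<Rightarrow> complex \<Rightarrow> ('x \<Rightarrow> complex) \<Rightarrow> bool" where
  "ae_continuous_eigenfunction X T \<mu> c f \<longleftrightarrow>
     (\<exists>g. continuous_map X euclidean g \<and> (AE x in \<mu>. f x = g x) \<and>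
          (\<forall>x\<in>topspace X. g (T x) = c * g x))"

definition all_eigenfunctions_continuous ::
  "'x topology \<Rightarrow> ('x \<Rightarrow> 'x) \<Rightarrow> 'x measure \<Rightarrow> bool" where
  "all_eigenfunctions_continuous X T \<mu> \<longleftrightarrow>
     (\<forall>c f. eigenfunction T \<mu> c f \<longrightarrow> ae_continuous_eigenfunction X T \<mu> c f)"

section \<open>The shift on sequences of matrices\<close>

text \<open>Sequences are indexed by \<open>{1..}\<close>, as extensional functions (\<open>undefined\<close> at 0).\<close>

definition seq_space :: "real mat set \<Rightarrow> (nat \<Rightarrow> real mat) set" where
  "seq_space MM = {M \<in> {1..} \<rightarrow>\<^sub>E MM. \<forall>n\<ge>1. dim_col (M (n+1)) = dim_row (M n)}"

definition seq_topology :: "real mat set \<Rightarrow> (nat \<Rightarrow> real mat) topology" where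
  "seq_topology MM =
     subtopology (product_topology (\<lambda>_. discrete_topology MM) {1..}) (seq_space MM)"

definition shift :: "(nat \<Rightarrow> real mat) \<Rightarrow> nat \<Rightarrow> real mat" where
  "shift M = (\<lambda>n\<in>{1..}. M (n+1))"

definition max_size :: "real mat set \<Rightarrow> nat" where
  "max_size MM = Max (dim_row ` MM \<union> dim_col ` MM)"

definition pad :: "nat \<Rightarrow> real mat \<Rightarrow> real mat" where
  "pad k m = mat k k (\<lambda>(i, j). if i < dim_row m \<and> j < dim_col m then m $$ (i, j) else 0)"

definition A_map :: "nat \<Rightarrow> (nat \<Rightarrow> real mat) \<Rightarrow> real Matrix.vec \<Rightarrow> real Matrix.vec" where
  "A_map k M v = pad k (M 2) *\<^sub>v v"

text \<open>\<open>A_cocycle k n M\<close> is \<open>A(S\<^sup>n\<^sup>-\<^sup>1M) \<circ> \<dots> \<circ> A(SM) \<circ> A(M)\<close>.\<close>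

primrec A_cocycle :: "nat \<Rightarrow> nat \<Rightarrow> (nat \<Rightarrow> real mat) \<Rightarrow> real Matrix.vec \<Rightarrow> real Matrix.vec" where
  "A_cocycle k 0 M = id"
| "A_cocycle k (Suc n) M = A_map k ((shift ^^ n) M) \<circ> A_cocycle k n M"

definition norm_on :: "nat \<Rightarrow> (real Matrix.vec \<Rightarrow> real) \<Rightarrow> bool" where
  "norm_on k N \<longleftrightarrow>
     (\<forall>v\<in>carrier_vec k. 0 \<le> N v \<and> (N v = 0 \<longleftrightarrow> v = 0\<^sub>v k)) \<and>
     (\<forall>c. \<forall>v\<in>carrier_vec k. N (c \<cdot>\<^sub>v v) = \<bar>c\<bar> * N v) \<and>
     (\<forall>v\<in>carrier_vec k. \<forall>w\<in>carrier_vec k. N (v + w) \<le> N v + N w)"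

definition log_ext :: "real \<Rightarrow> ereal" where
  "log_ext x = (if x = 0 then - \<infinity> else ereal (ln x))"

text \<open>The system is hyperbolic, as witnessed by the set \<open>B\<close>.\<close>

definition hyperbolic_on ::
  "real mat set \<Rightarrow> (nat \<Rightarrow> real mat) measure \<Rightarrow> (real Matrix.vec \<Rightarrow> real)
    \<Rightarrow> (nat \<Rightarrow> real mat) set \<Rightarrow> bool" where
  "hyperbolic_on MM \<nu> N B \<longleftrightarrow>
     B \<in> sets \<nu> \<and> shift ` B \<subseteq> B \<and> measure \<nu> B = 1 \<and>
     (\<forall>M\<in>B. \<forall>v\<in>carrier_vec (max_size MM). \<exists>l::ereal. l \<noteq> 0 \<and>
        (\<lambda>n. ereal (1 / real n) * log_ext (N (A_cocycle (max_size MM) n M v)))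
          \<longlonglongrightarrow> l)"

end

(*
  Let \<zeta> be an eigenvalue with eigenfunction f. On a tower with base B_k(n) the function f is determined by its
  restriction to the base, and it is L1-close to a function that is constant on the levels of P(n),
  hence close in mean to a constant d_k on each base. Linear recurrence makes every level of every
  tower of P(n+1) occupy a fixed proportion of the base of P(n) that contains it, so the constants
  of consecutive partitions are related up to small errors by powers of \<zeta>. For \<zeta> = 1 this
  gives ergodicity. In general, (KR6) puts both the base and its image under T^(-h_l(n+1)) into
  B_1(n), so \<zeta>^(h_l(n)) tends to 1 uniformly in l.

  The arguments v_l(n) of \<zeta>^(h_l(n)) therefore tend to 0. As h(n+1) = M(n+1) h(n), they satisfy
  v(n+1) = M(n+1) v(n) modulo 2 pi, and once they are small this is an exact equality: v(n) is
  an orbit of the cocycle that tends to 0. Its exponent is at most 0, hence negative by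
  hyperbolicity, and v(n) decays exponentially.

  Finally, the functions equal to \<zeta>^(-j) on the j-th level of each tower of P(n) differ for
  consecutive n by O(|v(n)|); they converge uniformly to a continuous eigenfunction g, and
  f / g is invariant, hence constant.
*)
theory Submission
  imports Defs
begin

section \<open>Towers\<close>

text \<open>Approximation in L1 makes the powers \<open>\<zeta> ^ h n l\<close> converge to 1
  without any rate, whereas the series that builds \<open>g\<close> needs a summable one;
  hyperbolicity bridges this gap. It speaks of linear orbits only, so the phases must satisfy the
  recurrence exactly. The rows of the associated matrices sum to at most the constant
  \<open>L\<close> of (LR), hence phases below \<open>1 / L\<close> have combinations of size at
  most 1 < pi and leave no ambiguity modulo 2 pi. This holds only from some index \<open>n0\<close>
  on: the orbit starts at \<open>(shift ^^ (n0 - 1)) M\<close>, again in \<open>B\<close>, whose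
  first cocycle matrix \<open>M (n0 + 1)\<close> sends the phases at \<open>n0\<close> to those at
  \<open>n0 + 1\<close>.

  Ergodicity of \<open>\<mu>\<close> is proved rather than assumed, and enters twice: it makes
  \<open>cmod (f x)\<close> almost everywhere constant, which keeps the constants on the bases away
  from 0 when the factor \<open>\<zeta> ^ h n l - 1\<close> is isolated, and it identifies
  \<open>f\<close> with a multiple of \<open>g\<close>.

  Levels are preimages under powers of \<open>T\<close>, so \<open>T\<close> descends the
  towers.\<close>

locale LR_partitions =
  fixes X :: "'x topology" and T :: "'x \<Rightarrow> 'x"
    and C :: "nat \<Rightarrow> nat" and B :: "nat \<Rightarrow> nat \<Rightarrow> 'x set" and h :: "nat \<Rightarrow> nat \<Rightarrow> nat"
  assumes LR: "LR_partition_sequence X T C B h"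
    and T_onto: "T ` topspace X = topspace X"
begin

section \<open>Levels and the unique address of a point\<close>

abbreviation lev :: "nat \<Rightarrow> nat \<Rightarrow> nat \<Rightarrow> 'x set" where
  "lev n k j \<equiv> level X T j (B n k)"

lemma T_in: "x \<in> topspace X \<Longrightarrow> T x \<in> topspace X"
  using T_onto by blast

lemma funpow_onto: "(T ^^ j) ` topspace X = topspace X"
proof (induction j)
  case (Suc j)
  then show ?case by (metis T_onto funpow.simps(2) image_comp)
qed simp

lemma CKR: "CKR_partition X T (C n) (B n) (h n)"
  using LR unfolding LR_partition_sequence_def by (elim conjE) (erule spec)

lemma C_pos: "1 \<in> {1..C n}"
  using CKR[of n] unfolding CKR_partition_def by auto

lemma h_pos: "k \<in> {1..C n} \<Longrightarrow> 0 < h n k"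
  using CKR[of n] unfolding CKR_partition_def by auto

lemma B_nonempty: "k \<in> {1..C n} \<Longrightarrow> B n k \<noteq> {}"
  using CKR[of n] unfolding CKR_partition_def by blast

lemma B_subset: "k \<in> {1..C n} \<Longrightarrow> B n k \<subseteq> topspace X"
  using CKR[of n] openin_subset unfolding CKR_partition_def by blast

lemma level_subset: "lev n k j \<subseteq> topspace X"
  by (auto simp: level_def)

lemma level_0: "k \<in> {1..C n} \<Longrightarrow> lev n k 0 = B n k"
  using B_subset by (auto simp: level_def)

lemma funpow_in: "x \<in> topspace X \<Longrightarrow> (T ^^ i) x \<in> topspace X"
  using funpow_onto by blast

lemma funpow_in_level:
  assumes "x \<in> topspace X"
  shows "(T ^^ i) x \<in> lev n k j \<longleftrightarrow> x \<in> lev n k (i + j)"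
  using assms funpow_in[OF assms] funpow_add[of j i T] by (simp add: level_def add.commute)

lemma T_in_level:
  assumes "x \<in> topspace X"
  shows "T x \<in> lev n k j \<longleftrightarrow> x \<in> lev n k (Suc j)"
  using funpow_in_level[OF assms, of 1] by simp

lemma level_nonempty:
  assumes "k \<in> {1..C n}" shows "lev n k j \<noteq> {}"
proof -
  obtain y where y: "y \<in> B n k" "y \<in> topspace X"
    using B_nonempty B_subset assms by blast
  then obtain x where "x \<in> topspace X" "y = (T ^^ j) x"
    using funpow_onto[of j] by (metis imageE)
  then show ?thesis using y by (auto simp: level_def)
qed

lemma cover:
  assumes "x \<in> topspace X"
  obtains k j where "k \<in> {1..C n}" "j < h n k" "x \<in> lev n k j"
proof -
  have "x \<in> \<Union> (tower_partition X T (C n) (B n) (h n))"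
    using CKR[of n] assms unfolding CKR_partition_def by simp
  then show ?thesis using that by (auto simp: tower_partition_def tower_indices_def)
qed

lemma level_unique:
  assumes "k \<in> {1..C n}" "j < h n k" "x \<in> lev n k j"
    and "k' \<in> {1..C n}" "j' < h n k'" "x \<in> lev n k' j'"
  shows "k = k'" "j = j'"
proof -
  have "disjoint_family_on (\<lambda>(k, j). lev n k j) (tower_indices (C n) (h n))"
    using CKR[of n] unfolding CKR_partition_def by simp
  moreover have "(k, j) \<in> tower_indices (C n) (h n)" "(k', j') \<in> tower_indices (C n) (h n)"
    using assms by (auto simp: tower_indices_def)
  ultimately have "(k, j) = (k', j')"
    using assms(3,6) disjoint_family_onD[of "\<lambda>(k, j). lev n k j" _ "(k, j)" "(k', j')"] by auto
  then show "k = k'" "j = j'" by auto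
qed

lemma base_subset: "l \<in> {1..C (Suc n)} \<Longrightarrow> B (Suc n) l \<subseteq> B n 1"
proof -
  have "\<forall>n. tower_base (C (n+1)) (B (n+1)) \<subseteq> B n 1"
    using LR unfolding LR_partition_sequence_def by (elim conjE)
  then show "l \<in> {1..C (Suc n)} \<Longrightarrow> B (Suc n) l \<subseteq> B n 1"
    by (fastforce simp: tower_base_def)
qed

lemma level_refines:
  assumes "l \<in> {1..C (Suc n)}" "j < h (Suc n) l"
  obtains k i where "k \<in> {1..C n}" "i < h n k" "lev (Suc n) l j \<subseteq> lev n k i"
proof -
  have "\<forall>n. \<forall>P \<in> tower_partition X T (C (n+1)) (B (n+1)) (h (n+1)).
        \<exists>Q \<in> tower_partition X T (C n) (B n) (h n). P \<subseteq> Q"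
    using LR unfolding LR_partition_sequence_def by (elim conjE)
  moreover have "lev (Suc n) l j \<in> tower_partition X T (C (n+1)) (B (n+1)) (h (n+1))"
    using assms by (force simp: tower_partition_def tower_indices_def)
  ultimately obtain Q where "Q \<in> tower_partition X T (C n) (B n) (h n)" "lev (Suc n) l j \<subseteq> Q"
    by meson
  then show ?thesis using that by (auto simp: tower_partition_def tower_indices_def)
qed

lemma visit_exists:
  assumes "l \<in> {1..C (Suc n)}" "k \<in> {1..C n}"
  obtains j where "j < h (Suc n) l" "lev (Suc n) l j \<subseteq> B n k"
proof -
  have "\<forall>n\<ge>1. \<forall>k\<in>{1..C (n-1)}. \<forall>l\<in>{1..C n}. \<exists>j<h n l. level X T j (B n l) \<subseteq> B (n-1) k"
    using LR unfolding LR_partition_sequence_def by (elim conjE)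
  then have "\<exists>j<h (Suc n) l. lev (Suc n) l j \<subseteq> B (Suc n - 1) k"
    using assms by (metis diff_Suc_1 le_add1 plus_1_eq_Suc)
  then show ?thesis using that by auto
qed

lemma linear_growth:
  obtains L :: real where "0 < L"
    "\<And>n l k. l \<in> {1..C (Suc n)} \<Longrightarrow> k \<in> {1..C n} \<Longrightarrow> h (Suc n) l \<le> L * h n k"
proof -
  have "\<exists>L::real. \<forall>n\<ge>1. \<forall>l\<in>{1..C n}. \<forall>k\<in>{1..C (n-1)}. real (h n l) \<le> L * real (h (n-1) k)"
    using LR unfolding LR_partition_sequence_def by (elim conjE)
  then obtain L :: real where L: "\<forall>n\<ge>1. \<forall>l\<in>{1..C n}. \<forall>k\<in>{1..C (n-1)}. real (h n l) \<le> L * real (h (n-1) k)"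
    by blast
  have *: "h (Suc n) l \<le> L * h n k" if "l \<in> {1..C (Suc n)}" "k \<in> {1..C n}" for n l k
    using L[rule_format, of "Suc n" l k] that by simp
  have "0 < real (h 1 1)" using h_pos[OF C_pos, of 1] by simp
  also have "\<dots> \<le> L * h 0 1" using *[of 1 0 1] C_pos by simp
  finally have "0 < L" by (simp add: zero_less_mult_iff)
  then show ?thesis using that * by blast
qed

lemma openin_level: "j < h n k \<Longrightarrow> k \<in> {1..C n} \<Longrightarrow> openin X (lev n k j)"
proof -
  assume *: "j < h n k" "k \<in> {1..C n}"
  have "X = topology_generated_by (\<Union>n. tower_partition X T (C n) (B n) (h n))"
    using LR unfolding LR_partition_sequence_def by (elim conjE)
  moreover have "lev n k j \<in> tower_partition X T (C n) (B n) (h n)"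
    using * by (force simp: tower_partition_def tower_indices_def)
  ultimately show ?thesis
    using topology_generated_by_Basis[of "lev n k j" "\<Union>n. tower_partition X T (C n) (B n) (h n)"] by auto
qed

section \<open>Passage between consecutive towers and consecutive partitions\<close>

lemma return_to_base:
  assumes "l \<in> {1..C n}" "x \<in> lev n l (h n l)"
  obtains k where "k \<in> {1..C n}" "x \<in> B n k"
proof -
  have x: "x \<in> topspace X" using assms level_subset by blast
  then obtain k j where kj: "k \<in> {1..C n}" "j < h n k" "x \<in> lev n k j" by (rule cover)
  \<comment> \<open>\<open>T\<close> lowers the level by one, so \<open>j > 0\<close> would put
    \<open>T x\<close> into level \<open>j - 1\<close> of tower \<open>k\<close> and into the top
    level of tower \<open>l\<close>; then \<open>k = l\<close> and \<open>j = h n l\<close>, which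
    is outside the tower.\<close>
  have "j = 0"
  proof (rule ccontr)
    assume "j \<noteq> 0"
    then obtain i where i: "j = Suc i" using not0_implies_Suc by blast
    have "T x \<in> lev n k i" using kj i T_in_level x by blast
    moreover have "T x \<in> lev n l (h n l - 1)" using T_in_level[OF x] assms h_pos by simp
    ultimately have "k = l" "i = h n l - 1"
      using level_unique[of k n i "T x" l "h n l - 1"] kj i assms(1) h_pos by auto
    then show False using kj i by auto
  qed
  then show ?thesis using that kj level_0 by blast
qed

text \<open>If \<open>T x\<close> were below the top of its tower, \<open>x\<close> would have an
  address at positive height besides its address in the base.\<close>

lemma base_in_top_preimage:
  assumes "k \<in> {1..C n}" "x \<in> B n k"
  obtains k' where "k' \<in> {1..C n}" "x \<in> lev n k' (h n k')"
proof -
  have x: "x \<in> topspace X" using assms B_subset by blast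
  obtain k' i where ki: "k' \<in> {1..C n}" "i < h n k'" "T x \<in> lev n k' i"
    using cover[OF T_in[OF x]] by blast
  then have xi: "x \<in> lev n k' (Suc i)" using T_in_level[OF x] by blast
  have "\<not> Suc i < h n k'"
    using level_unique[of k' n "Suc i" x k 0] xi ki assms level_0 h_pos by auto
  then have "Suc i = h n k'" using ki by auto
  then show ?thesis using that ki xi by metis
qed

text \<open>Descending \<open>j\<close> steps from \<open>x\<close> reaches the base of the finer
  partition, which lies in \<open>B n 1\<close>; in the coarser tower the height stays positive
  until step \<open>i\<close>, so \<open>i \<le> j\<close>. At step \<open>i\<close> one common
  point is enough, because (KR2) places the whole finer level in a single coarser one.\<close>

lemma visit_of_level:
  assumes "l \<in> {1..C (Suc n)}" "j < h (Suc n) l" "x \<in> lev (Suc n) l j"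
    and "k \<in> {1..C n}" "i < h n k" "x \<in> lev n k i"
  shows "i \<le> j" "lev (Suc n) l (j - i) \<subseteq> B n k"
proof -
  have x: "x \<in> topspace X" using assms level_subset by blast
  show le: "i \<le> j"
  proof (rule ccontr)
    assume "\<not> i \<le> j"
    then have "(T ^^ j) x \<in> lev n k (i - j)" using funpow_in_level[OF x] assms by simp
    moreover have "(T ^^ j) x \<in> B n 1"
      using assms base_subset by (auto simp: level_def)
    ultimately have "i - j = 0"
      using level_unique[of k n "i - j" "(T ^^ j) x" 1 0] assms level_0 C_pos h_pos by auto
    then show False using \<open>\<not> i \<le> j\<close> by simp
  qed
  have "j - i < h (Suc n) l" using assms(2) by simp
  then obtain k' i' where k': "k' \<in> {1..C n}" "i' < h n k'" "lev (Suc n) l (j - i) \<subseteq> lev n k' i'"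
    by (rule level_refines[OF assms(1)])
  have "(T ^^ i) x \<in> lev (Suc n) l (j - i)" "(T ^^ i) x \<in> lev n k 0"
    using funpow_in_level[OF x] assms le by auto
  then have "k = k'" "0 = i'"
    using level_unique[of k n 0 "(T ^^ i) x" k' i'] k' assms by auto
  then show "lev (Suc n) l (j - i) \<subseteq> B n k" using k' level_0 by auto
qed

text \<open>\<open>card (visits n l k)\<close> is the entry in row \<open>l - 1\<close> and column
  \<open>k - 1\<close> of \<open>assoc_matrix\<close> at index \<open>Suc n\<close>.\<close>

definition visits :: "nat \<Rightarrow> nat \<Rightarrow> nat \<Rightarrow> nat set" where
  "visits n l k = {j. j < h (Suc n) l \<and> lev (Suc n) l j \<subseteq> B n k}"

text \<open>Otherwise the coarse tower begun at time \<open>j\<close> would still be unfinished at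
  index \<open>h (Suc n) l\<close>. The level of that index lies in the base of the finer partition,
  hence in \<open>B n 1\<close>, so its points would have both a positive height and height
  0.\<close>

lemma visit_tower_fits:
  assumes l: "l \<in> {1..C (Suc n)}" and k: "k \<in> {1..C n}" and j: "j \<in> visits n l k" and i: "i < h n k"
  shows "j + i < h (Suc n) l"
proof (rule ccontr)
  assume "\<not> j + i < h (Suc n) l"
  moreover have "j < h (Suc n) l" using j by (simp add: visits_def)
  ultimately obtain i' where i': "j + i' = h (Suc n) l" "0 < i'" "i' \<le> i"
    by (metis add_diff_cancel_left' diff_le_mono le_add_diff_inverse less_imp_le not_less zero_less_diff)
  obtain y where y: "y \<in> lev (Suc n) l (h (Suc n) l)" using level_nonempty[OF l] by blast
  have yX: "y \<in> topspace X" using y level_subset by blast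
  obtain l' where "l' \<in> {1..C (Suc n)}" "y \<in> B (Suc n) l'" using return_to_base[OF l y] .
  then have y1: "y \<in> lev n 1 0" using base_subset level_0 C_pos by blast
  have "(T ^^ i') y \<in> lev (Suc n) l j" using funpow_in_level[OF yX] i' y by (simp add: add.commute)
  then have "(T ^^ i') y \<in> lev n k 0" using j level_0[OF k] by (auto simp: visits_def)
  then have "y \<in> lev n k i'" using funpow_in_level[OF yX] by simp
  then show False using level_unique[of k n i' y 1 0] y1 i' i k C_pos h_pos by auto
qed

text \<open>Each level of a finer tower is located by the coarse tower it belongs to, the time of
  the visit that opens this tower and the height in it: the triples \<open>(k, j, i)\<close> in
  \<open>S\<close> correspond one to one to the indices \<open>j + i\<close>.\<close>

lemma height_recurrence:
  assumes l: "l \<in> {1..C (Suc n)}"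
  shows "h (Suc n) l = (\<Sum>k\<in>{1..C n}. card (visits n l k) * h n k)"
proof -
  define S where "S = (SIGMA k:{1..C n}. visits n l k \<times> {..<h n k})"
  define \<phi> :: "nat \<times> nat \<times> nat \<Rightarrow> nat" where "\<phi> = (\<lambda>(k, j, i). j + i)"
  have in_lev: "x \<in> lev n k i"
    if "(k, j, i) \<in> S" "x \<in> lev (Suc n) l (j + i)" for k j i x
  proof -
    have x: "x \<in> topspace X" using that level_subset by blast
    have "(T ^^ i) x \<in> lev (Suc n) l j" using that funpow_in_level[OF x] by (simp add: add.commute)
    then have "(T ^^ i) x \<in> lev n k 0" using that level_0 by (auto simp: S_def visits_def)
    then show ?thesis using funpow_in_level[OF x] by simp
  qed
  have "inj_on \<phi> S"
  proof (rule inj_onI)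
    fix p q assume pq: "p \<in> S" "q \<in> S" "\<phi> p = \<phi> q"
    obtain k j i where p: "p = (k, j, i)" using prod_cases3 by blast
    obtain k' j' i' where q: "q = (k', j', i')" using prod_cases3 by blast
    obtain x where x: "x \<in> lev (Suc n) l (j + i)" using level_nonempty[OF l] by blast
    have e: "j + i = j' + i'" using pq p q by (simp add: \<phi>_def)
    have "x \<in> lev n k i" "x \<in> lev n k' i'" using in_lev x pq p q e by auto
    moreover have "k \<in> {1..C n}" "i < h n k" "k' \<in> {1..C n}" "i' < h n k'"
      using pq p q by (auto simp: S_def)
    ultimately have "k = k'" "i = i'" using level_unique by metis+
    then show "p = q" using p q e by simp
  qed
  moreover have "\<phi> ` S = {..<h (Suc n) l}"
  proof
    show "\<phi> ` S \<subseteq> {..<h (Suc n) l}" using visit_tower_fits[OF l] by (auto simp: S_def \<phi>_def)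
    show "{..<h (Suc n) l} \<subseteq> \<phi> ` S"
    proof
      fix p assume "p \<in> {..<h (Suc n) l}"
      then have p: "p < h (Suc n) l" by simp
      obtain x where x: "x \<in> lev (Suc n) l p" using level_nonempty[OF l] by blast
      then have "x \<in> topspace X" using level_subset by blast
      then obtain k i where ki: "k \<in> {1..C n}" "i < h n k" "x \<in> lev n k i" by (rule cover)
      have "(k, p - i, i) \<in> S" "\<phi> (k, p - i, i) = p"
        using visit_of_level[OF l p x ki] ki p by (auto simp: S_def visits_def \<phi>_def)
      then show "p \<in> \<phi> ` S" by force
    qed
  qed
  ultimately have "card {..<h (Suc n) l} = card S" by (metis card_image)
  also have "card S = (\<Sum>k\<in>{1..C n}. card (visits n l k \<times> {..<h n k}))"
    unfolding S_def by (rule card_SigmaI) (auto simp: visits_def)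
  finally show ?thesis by (simp add: card_cartesian_product)
qed

text \<open>The time of a visit to the base of the \<open>n\<close>-th partition is the sum of the heights of the towers crossed
  before; their number is at most \<open>j / hm\<close>.\<close>

lemma power_visit_time:
  fixes \<zeta> :: complex and \<delta> hm :: real
  assumes "cmod \<zeta> = 1" and l: "l \<in> {1..C (Suc n)}"
    and hm: "\<And>k. k \<in> {1..C n} \<Longrightarrow> hm \<le> h n k" "0 \<le> hm"
    and \<delta>: "\<And>k. k \<in> {1..C n} \<Longrightarrow> cmod (\<zeta> ^ h n k - 1) \<le> \<delta>"
    and "k \<in> {1..C n}" "j \<in> visits n l k"
  shows "hm * cmod (\<zeta> ^ j - 1) \<le> j * \<delta>"
  using assms(6,7)
proof (induction j arbitrary: k rule: less_induct)
  case (less j)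
  show ?case
  proof (cases "j = 0")
    case False
    have \<delta>0: "0 \<le> \<delta>" using \<delta>[OF less.prems(1)] norm_ge_zero order_trans by blast
    obtain x where x: "x \<in> lev (Suc n) l j" using level_nonempty[OF l] by blast
    then have xX: "x \<in> topspace X" using level_subset by blast
    have jl: "j < h (Suc n) l" using less.prems by (simp add: visits_def)
    \<comment> \<open>The tower crossed just before time \<open>j\<close> is the one whose top level
      contains \<open>T x\<close>; it was opened by the visit at time
      \<open>j' = j - h n k'\<close>, to which the induction applies.\<close>
    have "x \<in> B n k" using x less.prems by (auto simp: visits_def)
    then obtain k' where k': "k' \<in> {1..C n}" "x \<in> lev n k' (h n k')"
      using base_in_top_preimage less.prems by blast
    have hk': "0 < h n k'" using h_pos k' by blast
    have "T x \<in> lev (Suc n) l (j - 1)" "T x \<in> lev n k' (h n k' - 1)"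
      using T_in_level[OF xX] x k' False hk' by auto
    then have v: "h n k' - 1 \<le> j - 1" "lev (Suc n) l (j - 1 - (h n k' - 1)) \<subseteq> B n k'"
      using visit_of_level[OF l, of "j - 1" "T x" k' "h n k' - 1"] jl k' hk' by auto
    define j' where "j' = j - h n k'"
    have j': "j = j' + h n k'" "j' < j" "j' \<in> visits n l k'"
      using v False hk' jl by (auto simp: j'_def visits_def)
    have "\<zeta> ^ j - 1 = \<zeta> ^ j' * (\<zeta> ^ h n k' - 1) + (\<zeta> ^ j' - 1)"
      by (simp add: j'(1) power_add algebra_simps)
    then have "cmod (\<zeta> ^ j - 1) \<le> cmod (\<zeta> ^ j' * (\<zeta> ^ h n k' - 1)) + cmod (\<zeta> ^ j' - 1)"
      by (metis norm_triangle_ineq)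
    also have "\<dots> \<le> \<delta> + cmod (\<zeta> ^ j' - 1)"
      using \<delta>[OF k'(1)] assms(1) by (simp add: norm_mult norm_power)
    finally have "hm * cmod (\<zeta> ^ j - 1) \<le> hm * \<delta> + hm * cmod (\<zeta> ^ j' - 1)"
      using hm(2) by (metis distrib_left mult_left_mono)
    also have "\<dots> \<le> h n k' * \<delta> + j' * \<delta>"
      using less.IH[OF j'(2) k'(1) j'(3)] hm(1)[OF k'(1)] \<delta>0 by (intro add_mono mult_right_mono) auto
    also have "\<dots> = j * \<delta>" using j'(1) by (simp add: algebra_simps)
    finally show ?thesis .
  qed simp
qed

text \<open>With \<open>hm\<close> the least height at stage \<open>n\<close>, (LR) gives
  \<open>j < h (Suc n) l \<le> L * hm\<close>, so at most \<open>L\<close> coarse towers are crossed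
  before the visit, each costing at most \<open>\<delta>\<close>.\<close>

lemma power_visit_time_le:
  fixes \<zeta> :: complex and \<delta> L :: real
  assumes "cmod \<zeta> = 1" and l: "l \<in> {1..C (Suc n)}"
    and L: "\<And>k. k \<in> {1..C n} \<Longrightarrow> h (Suc n) l \<le> L * h n k"
    and \<delta>: "\<And>k. k \<in> {1..C n} \<Longrightarrow> cmod (\<zeta> ^ h n k - 1) \<le> \<delta>"
    and k: "k \<in> {1..C n}" and j: "j \<in> visits n l k"
  shows "cmod (\<zeta> ^ j - 1) \<le> L * \<delta>"
proof -
  define hm where "hm = Min (h n ` {1..C n})"
  have "hm \<in> h n ` {1..C n}" unfolding hm_def using C_pos by (intro Min_in) auto
  then obtain k0 where k0: "k0 \<in> {1..C n}" "hm = h n k0" by blast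
  have \<delta>0: "0 \<le> \<delta>" using \<delta>[OF k] norm_ge_zero order_trans by blast
  have "hm \<le> h n k" if "k \<in> {1..C n}" for k using that by (simp add: hm_def)
  then have "real hm * cmod (\<zeta> ^ j - 1) \<le> j * \<delta>"
    using power_visit_time[OF assms(1) l, of "real hm" \<delta>] \<delta> k j by auto
  also have "\<dots> \<le> (L * hm) * \<delta>"
    using j L[OF k0(1)] k0(2) \<delta>0 by (intro mult_right_mono) (auto simp: visits_def)
  finally have "real hm * cmod (\<zeta> ^ j - 1) \<le> real hm * (L * \<delta>)" by (simp add: mult_ac)
  moreover have "0 < real hm" using k0 h_pos by simp
  ultimately show ?thesis by simp
qed

section \<open>Approximate eigenfunctions built from the towers\<close>

text \<open>For \<open>\<bar>\<zeta>\<bar> = 1\<close> the function below is \<open>\<zeta>\<^sup>-\<^sup>j\<close> on the \<open>j\<close>-th levels of the towers; it is junk outside \<open>topspace X\<close>.\<close>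

definition level_phase :: "complex \<Rightarrow> nat \<Rightarrow> 'x \<Rightarrow> complex" where
  "level_phase \<zeta> n x =
     cnj \<zeta> ^ snd (SOME p. p \<in> tower_indices (C n) (h n) \<and> x \<in> lev n (fst p) (snd p))"

lemma level_phase_eq:
  assumes "k \<in> {1..C n}" "j < h n k" "x \<in> lev n k j"
  shows "level_phase \<zeta> n x = cnj \<zeta> ^ j"
proof -
  define P where "P = (\<lambda>p. p \<in> tower_indices (C n) (h n) \<and> x \<in> lev n (fst p) (snd p))"
  have "P (k, j)" using assms by (simp add: P_def tower_indices_def)
  then have "P (SOME p. P p)" by (rule someI)
  then have "snd (SOME p. P p) = j"
    using assms level_unique(2)[of "fst (SOME p. P p)" n "snd (SOME p. P p)" x k j]
    by (auto simp: P_def tower_indices_def)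
  then show ?thesis unfolding level_phase_def P_def by simp
qed

text \<open>A point at height \<open>j\<close> in the finer and \<open>i\<close> in the coarser
  partition sits over a visit at time \<open>j - i\<close>, and the two exponents differ by just
  this time.\<close>

lemma level_phase_Suc:
  fixes \<zeta> :: complex and \<delta> L :: real
  assumes "cmod \<zeta> = 1" and x: "x \<in> topspace X"
    and L: "\<And>k l. k \<in> {1..C n} \<Longrightarrow> l \<in> {1..C (Suc n)} \<Longrightarrow> h (Suc n) l \<le> L * h n k"
    and \<delta>: "\<And>k. k \<in> {1..C n} \<Longrightarrow> cmod (\<zeta> ^ h n k - 1) \<le> \<delta>"
  shows "cmod (level_phase \<zeta> (Suc n) x - level_phase \<zeta> n x) \<le> L * \<delta>"
proof -
  obtain l j where l: "l \<in> {1..C (Suc n)}" "j < h (Suc n) l" "x \<in> lev (Suc n) l j"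
    using cover[OF x] .
  obtain k i where k: "k \<in> {1..C n}" "i < h n k" "x \<in> lev n k i"
    using cover[OF x] .
  have ij: "i \<le> j" and v: "j - i \<in> visits n l k"
    using visit_of_level[OF l k] l by (auto simp: visits_def)
  have "cnj \<zeta> ^ j - cnj \<zeta> ^ i = cnj (\<zeta> ^ i * (\<zeta> ^ (j - i) - 1))"
    using ij by (simp add: algebra_simps power_add[symmetric])
  then have "cmod (cnj \<zeta> ^ j - cnj \<zeta> ^ i) = cmod (\<zeta> ^ (j - i) - 1)"
    using assms(1) by (metis complex_mod_cnj mult_1 norm_mult norm_power power_one)
  also have "\<dots> \<le> L * \<delta>" using power_visit_time_le[OF assms(1) l(1) _ \<delta> k(1) v] L l(1) by blast
  finally show ?thesis using level_phase_eq l k by metis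
qed

text \<open>Inside the towers the equation is exact. The defect comes only from the base, which
  \<open>T\<close> sends to the top level of some tower \<open>k'\<close>, with an error of modulus
  \<open>cmod (\<zeta> ^ h n k' - 1)\<close>.\<close>

lemma level_phase_T:
  fixes \<zeta> :: complex
  assumes "cmod \<zeta> = 1" and x: "x \<in> topspace X"
    and \<delta>: "\<And>k. k \<in> {1..C n} \<Longrightarrow> cmod (\<zeta> ^ h n k - 1) \<le> \<delta>"
  shows "cmod (level_phase \<zeta> n (T x) - \<zeta> * level_phase \<zeta> n x) \<le> \<delta>"
proof -
  have \<zeta>: "\<zeta> * cnj \<zeta> = 1" using assms(1) by (simp add: complex_norm_square[symmetric])
  have zS: "\<zeta> * cnj \<zeta> ^ Suc i = cnj \<zeta> ^ i" for i by (simp add: \<zeta> mult.assoc[symmetric])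
  obtain k j where k: "k \<in> {1..C n}" "j < h n k" "x \<in> lev n k j"
    using cover[OF x] .
  have \<delta>0: "0 \<le> \<delta>" using \<delta>[OF k(1)] norm_ge_zero order_trans by blast
  show ?thesis
  proof (cases j)
    case (Suc i)
    have "T x \<in> lev n k i" using k Suc T_in_level[OF x] by blast
    then have "level_phase \<zeta> n (T x) = cnj \<zeta> ^ i" using level_phase_eq k Suc by simp
    moreover have "\<zeta> * cnj \<zeta> ^ j = cnj \<zeta> ^ i" by (simp only: Suc zS)
    ultimately show ?thesis using level_phase_eq[OF k] \<delta>0 by simp
  next
    case 0
    then have "x \<in> B n k" using k level_0 by simp
    then obtain k' where k': "k' \<in> {1..C n}" "x \<in> lev n k' (h n k')"
      using base_in_top_preimage k by blast
    then obtain i where i: "h n k' = Suc i" using h_pos gr0_implies_Suc by metis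
    have "T x \<in> lev n k' i" using k' i T_in_level[OF x] by simp
    then have "level_phase \<zeta> n (T x) = cnj \<zeta> ^ i" using level_phase_eq k' i by simp
    moreover have "cnj \<zeta> ^ i - \<zeta> = \<zeta> * cnj (\<zeta> ^ h n k' - 1)"
      using zS[of i] i by (simp add: algebra_simps)
    ultimately show ?thesis
      using level_phase_eq[OF k] 0 assms(1) \<delta>[OF k'(1)]
      by (simp add: norm_mult del: complex_cnj_diff complex_cnj_power)
  qed
qed

lemma continuous_eigenfunction_of_summable:
  fixes \<zeta> :: complex and \<delta> :: "nat \<Rightarrow> real"
  assumes \<zeta>: "cmod \<zeta> = 1"
    and \<delta>: "\<And>n k. k \<in> {1..C n} \<Longrightarrow> cmod (\<zeta> ^ h n k - 1) \<le> \<delta> n"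
    and summable: "summable \<delta>"
  obtains g where "continuous_map X euclidean g"
    "\<And>x. x \<in> topspace X \<Longrightarrow> cmod (g x) = 1"
    "\<And>x. x \<in> topspace X \<Longrightarrow> g (T x) = \<zeta> * g x"
proof -
  obtain L :: real where L: "0 < L"
    "\<And>n l k. l \<in> {1..C (Suc n)} \<Longrightarrow> k \<in> {1..C n} \<Longrightarrow> h (Suc n) l \<le> L * h n k"
    using linear_growth by blast
  define g where "g x = level_phase \<zeta> 0 x + (\<Sum>n. level_phase \<zeta> (Suc n) x - level_phase \<zeta> n x)" for x
  have "uniform_limit (topspace X) (\<lambda>n x. \<Sum>i<n. level_phase \<zeta> (Suc i) x - level_phase \<zeta> i x)
      (\<lambda>x. \<Sum>i. level_phase \<zeta> (Suc i) x - level_phase \<zeta> i x) sequentially"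
    using level_phase_Suc[OF \<zeta> _ _ \<delta>] L summable
    by (intro Weierstrass_m_test[where M = "\<lambda>n. L * \<delta> n"]) (auto intro: summable_mult)
  then have "uniform_limit (topspace X)
      (\<lambda>n x. level_phase \<zeta> 0 x + (\<Sum>i<n. level_phase \<zeta> (Suc i) x - level_phase \<zeta> i x)) g sequentially"
    unfolding g_def by (intro uniform_limit_intros)
  then have unif: "uniform_limit (topspace X) (level_phase \<zeta>) g sequentially"
    by (simp add: sum_lessThan_telescope[where f = "\<lambda>i. level_phase \<zeta> i x" for x])
  have lim: "(\<lambda>n. level_phase \<zeta> n x) \<longlonglongrightarrow> g x" if "x \<in> topspace X" for x
    using unif that by (rule tendsto_uniform_limitI)
  show ?thesis
  proof
    show "cmod (g x) = 1" if x: "x \<in> topspace X" for x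
    proof -
      have "cmod (level_phase \<zeta> n x) = 1" for n by (simp add: level_phase_def norm_power \<zeta>)
      then show ?thesis using tendsto_norm[OF lim[OF x]] by (simp add: LIMSEQ_const_iff)
    qed
    show "g (T x) = \<zeta> * g x" if x: "x \<in> topspace X" for x
    proof -
      have "(\<lambda>n. level_phase \<zeta> n (T x) - \<zeta> * level_phase \<zeta> n x) \<longlonglongrightarrow> g (T x) - \<zeta> * g x"
        using lim x T_in[OF x] by (intro tendsto_intros)
      moreover have "(\<lambda>n. level_phase \<zeta> n (T x) - \<zeta> * level_phase \<zeta> n x) \<longlonglongrightarrow> 0"
      proof (rule Lim_null_comparison)
        show "\<forall>\<^sub>F n in sequentially. cmod (level_phase \<zeta> n (T x) - \<zeta> * level_phase \<zeta> n x) \<le> \<delta> n"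
          by (intro always_eventually allI level_phase_T[OF \<zeta> x \<delta>])
        show "\<delta> \<longlonglongrightarrow> 0" by (rule summable_LIMSEQ_zero[OF summable])
      qed
      ultimately have "g (T x) - \<zeta> * g x = 0" by (rule LIMSEQ_unique)
      then show ?thesis by simp
    qed
    show "continuous_map X euclidean g"
      unfolding continuous_map_def
    proof (intro conjI allI impI)
      fix U :: "complex set" assume "openin euclidean U"
      then have U: "open U" by simp
      show "openin X {x \<in> topspace X. g x \<in> U}"
      proof (subst openin_subopen, intro ballI)
        fix x assume "x \<in> {x \<in> topspace X. g x \<in> U}"
        then have x: "x \<in> topspace X" "g x \<in> U" by auto
        then obtain e where e: "0 < e" "ball (g x) e \<subseteq> U" using U openE by blast
        have "\<forall>\<^sub>F n in sequentially. \<forall>y\<in>topspace X. dist (level_phase \<zeta> n y) (g y) < e/2"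
          using unif e by (intro uniform_limitD) auto
        from eventually_happens'[OF sequentially_bot this]
        obtain n where n: "\<forall>y\<in>topspace X. dist (level_phase \<zeta> n y) (g y) < e/2" ..
        \<comment> \<open>\<open>level_phase \<zeta> n\<close> is constant on the open level through
          \<open>x\<close>, so this level serves as the neighbourhood and two errors of
          \<open>e / 2\<close> suffice.\<close>
        obtain k j where k: "k \<in> {1..C n}" "j < h n k" "x \<in> lev n k j" using cover[OF x(1)] .
        have "g y \<in> U" if y: "y \<in> lev n k j" for y
        proof -
          have yX: "y \<in> topspace X" using y level_subset by blast
          have "level_phase \<zeta> n x = level_phase \<zeta> n y" using level_phase_eq k y by simp
          moreover have "dist (level_phase \<zeta> n y) (g y) < e/2" "dist (level_phase \<zeta> n x) (g x) < e/2"
            using n yX x by auto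
          ultimately have "dist (level_phase \<zeta> n x) (g x) < e/2" "dist (level_phase \<zeta> n x) (g y) < e/2"
            by simp_all
          then have "dist (g x) (g y) < e" by (rule dist_triangle_half_r)
          then show ?thesis using e(2) by (simp add: subset_iff)
        qed
        then show "\<exists>V. openin X V \<and> x \<in> V \<and> V \<subseteq> {x \<in> topspace X. g x \<in> U}"
          using openin_level[OF k(2,1)] k(3) level_subset by blast
      qed
    qed auto
  qed
qed

section \<open>Row sums of the matrices and the phases\<close>

lemma sum_card_visits_le:
  fixes L :: real
  assumes l: "l \<in> {1..C (Suc n)}" and L: "\<And>k. k \<in> {1..C n} \<Longrightarrow> h (Suc n) l \<le> L * h n k"
  shows "(\<Sum>k\<in>{1..C n}. real (card (visits n l k))) \<le> L"
proof -
  \<comment> \<open>Replacing all heights by the least one in the height recurrence bounds the row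
    sum by \<open>h (Suc n) l / hm\<close>, hence by \<open>L\<close>.\<close>
  define hm where "hm = Min (h n ` {1..C n})"
  have "hm \<in> h n ` {1..C n}" unfolding hm_def using C_pos by (intro Min_in) auto
  then obtain k0 where k0: "k0 \<in> {1..C n}" "hm = h n k0" by blast
  have hm: "hm \<le> h n k" if "k \<in> {1..C n}" for k using that by (simp add: hm_def)
  have "(\<Sum>k\<in>{1..C n}. card (visits n l k) * hm) \<le> h (Suc n) l"
    unfolding height_recurrence[OF l] by (intro sum_mono mult_left_mono hm) auto
  then have "real (\<Sum>k\<in>{1..C n}. card (visits n l k) * hm) \<le> h (Suc n) l"
    by (rule of_nat_mono)
  then have "real hm * (\<Sum>k\<in>{1..C n}. real (card (visits n l k))) \<le> h (Suc n) l"
    by (simp add: sum_distrib_left mult.commute)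
  also have "\<dots> \<le> real hm * L" using L[OF k0(1)] k0(2) by (simp add: mult.commute)
  finally show ?thesis using h_pos[OF k0(1)] k0(2) by simp
qed

text \<open>The principal argument of \<open>\<zeta> ^ h n l\<close>, in \<open>(-pi, pi]\<close>.
  On the unit circle the logarithm has no real part, so the phase determines the power.\<close>

definition phase :: "complex \<Rightarrow> nat \<Rightarrow> nat \<Rightarrow> real" where
  "phase \<zeta> n l = Im (Ln (\<zeta> ^ h n l))"

lemma iexp_phase:
  assumes "cmod \<zeta> = 1" shows "iexp (phase \<zeta> n l) = \<zeta> ^ h n l"
proof -
  have nz: "\<zeta> ^ h n l \<noteq> 0" using assms by auto
  have "Re (Ln (\<zeta> ^ h n l)) = 0" using nz assms by (simp add: norm_power)
  then have "Ln (\<zeta> ^ h n l) = \<i> * phase \<zeta> n l" by (simp add: phase_def complex_eq_iff)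
  then show ?thesis using exp_Ln[OF nz] by simp
qed

text \<open>A chord of the unit circle is at most as long as its arc; here this is the remainder of
  order 0 of the exponential series.\<close>

lemma norm_power_height_le:
  assumes "cmod \<zeta> = 1" shows "cmod (\<zeta> ^ h n l - 1) \<le> \<bar>phase \<zeta> n l\<bar>"
  using iexp_approx1[of "phase \<zeta> n l" 0] iexp_phase[OF assms, of n l] by simp

lemma phase_Suc:
  assumes \<zeta>: "cmod \<zeta> = 1" and l: "l \<in> {1..C (Suc n)}"
    and small: "\<bar>\<Sum>k\<in>{1..C n}. card (visits n l k) * phase \<zeta> n k\<bar> < pi"
  shows "phase \<zeta> (Suc n) l = (\<Sum>k\<in>{1..C n}. card (visits n l k) * phase \<zeta> n k)"
proof -
  let ?s = "\<Sum>k\<in>{1..C n}. card (visits n l k) * phase \<zeta> n k"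
  have "iexp ?s = (\<Prod>k\<in>{1..C n}. exp (of_nat (card (visits n l k)) * (\<i> * phase \<zeta> n k)))"
    by (subst exp_sum[symmetric]) (auto simp: sum_distrib_left mult_ac)
  also have "\<dots> = (\<Prod>k\<in>{1..C n}. (\<zeta> ^ h n k) ^ card (visits n l k))"
    by (intro prod.cong refl) (simp only: exp_of_nat_mult iexp_phase[OF \<zeta>])
  also have "\<dots> = \<zeta> ^ h (Suc n) l"
    by (simp add: height_recurrence[OF l] power_sum power_mult[symmetric] mult.commute)
  finally have "Ln (\<zeta> ^ h (Suc n) l) = Ln (iexp ?s)" by simp
  \<comment> \<open>The bound on the sum keeps it inside the principal branch.\<close>
  also have "\<dots> = \<i> * ?s" using small by (intro Ln_exp) (auto simp: abs_less_iff)
  finally show ?thesis by (simp add: phase_def)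
qed

end

section \<open>Invariant measures\<close>

lemma exists_below_average:
  fixes a :: "nat \<Rightarrow> real"
  assumes "0 < m"
  obtains j where "j < m" "m * a j \<le> (\<Sum>j<m. a j)"
proof -
  have "\<exists>j<m. m * a j \<le> (\<Sum>j<m. a j)"
  proof (rule ccontr)
    assume "\<not> ?thesis"
    then have *: "\<And>j. j < m \<Longrightarrow> (\<Sum>j<m. a j) < m * a j" by force
    have "(\<Sum>i<m. \<Sum>j<m. a j) < (\<Sum>i<m. m * a i)"
      using * assms by (intro sum_strict_mono) auto
    then show False by (simp add: sum_distrib_left)
  qed
  then show ?thesis using that by blast
qed

locale LR_measure = LR_partitions X T C B h + prob_space \<mu>
  for X :: "'x topology" and T :: "'x \<Rightarrow> 'x"
    and C :: "nat \<Rightarrow> nat" and B :: "nat \<Rightarrow> nat \<Rightarrow> 'x set" and h :: "nat \<Rightarrow> nat \<Rightarrow> nat"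
    and \<mu> :: "'x measure" +
  assumes sets_\<mu>: "sets \<mu> = sets (sigma (topspace X) {U. openin X U})"
    and T_measurable [measurable]: "T \<in> measurable \<mu> \<mu>"
    and T_invariant: "distr \<mu> \<mu> T = \<mu>"
begin

lemma openin_Pow: "{U. openin X U} \<subseteq> Pow (topspace X)"
  by (auto dest: openin_subset)

lemma space_\<mu>: "space \<mu> = topspace X"
  using sets_eq_imp_space_eq[OF sets_\<mu>] space_measure_of[OF openin_Pow] by simp

lemma openin_sets: "openin X U \<Longrightarrow> U \<in> sets \<mu>"
  unfolding sets_\<mu> sets_measure_of[OF openin_Pow] by (rule sigma_sets.Basic) simp

lemma funpow_measurable [measurable]: "T ^^ j \<in> measurable \<mu> \<mu>"
proof (induction j)
  case (Suc j)
  then show ?case using measurable_comp[OF Suc T_measurable] by simp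
qed (simp add: id_def)

lemma funpow_invariant: "distr \<mu> \<mu> (T ^^ j) = \<mu>"
proof (induction j)
  case (Suc j)
  have "distr \<mu> \<mu> (T ^^ Suc j) = distr (distr \<mu> \<mu> (T ^^ j)) \<mu> T"
    by (subst distr_distr) simp_all
  then show ?case by (simp only: Suc T_invariant)
qed (simp add: id_def distr_id)

lemma B_sets [measurable]: "k \<in> {1..C n} \<Longrightarrow> B n k \<in> sets \<mu>"
  using openin_level[of 0 n k] level_0 h_pos openin_sets by auto

lemma level_vimage: "lev n k j = (T ^^ j) -` B n k \<inter> space \<mu>"
  by (auto simp: level_def space_\<mu>)

lemma level_sets [measurable]: "k \<in> {1..C n} \<Longrightarrow> lev n k j \<in> sets \<mu>"
  unfolding level_vimage by measurable

lemma prob_level: "k \<in> {1..C n} \<Longrightarrow> prob (lev n k j) = prob (B n k)"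
  using measure_distr[OF funpow_measurable B_sets, of k n j] funpow_invariant level_vimage by simp

lemma integral_funpow:
  fixes \<phi> :: "'x \<Rightarrow> real"
  assumes "\<phi> \<in> borel_measurable \<mu>"
  shows "(\<integral>x. \<phi> ((T ^^ j) x) \<partial>\<mu>) = (\<integral>x. \<phi> x \<partial>\<mu>)"
  using integral_distr[OF funpow_measurable assms, of j] funpow_invariant by simp

lemma integral_level:
  fixes \<phi> :: "'x \<Rightarrow> real"
  assumes [measurable]: "\<phi> \<in> borel_measurable \<mu>" "k \<in> {1..C n}"
  shows "(LINT x:lev n k j|\<mu>. \<phi> ((T ^^ j) x)) = (LINT x:B n k|\<mu>. \<phi> x)"
proof -
  have "(LINT x:lev n k j|\<mu>. \<phi> ((T ^^ j) x)) =
      (\<integral>x. indicator (B n k) ((T ^^ j) x) * \<phi> ((T ^^ j) x) \<partial>\<mu>)"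
    unfolding set_lebesgue_integral_def
    by (rule Bochner_Integration.integral_cong) (auto simp: level_vimage indicator_def)
  also have "\<dots> = (\<integral>x. indicator (B n k) x * \<phi> x \<partial>\<mu>)"
    by (rule integral_funpow[where \<phi> = "\<lambda>x. indicator (B n k) x * \<phi> x"]) measurable
  finally show ?thesis by (simp add: set_lebesgue_integral_def)
qed

lemma sum_indicator_levels:
  fixes \<phi> :: "nat \<Rightarrow> nat \<Rightarrow> 'b::real_normed_vector"
  assumes "k \<in> {1..C n}" "j < h n k" "x \<in> lev n k j"
  shows "(\<Sum>k\<in>{1..C n}. \<Sum>j<h n k. indicator (lev n k j) x *\<^sub>R \<phi> k j) = \<phi> k j"
proof -
  have *: "indicator (lev n k' j') x *\<^sub>R \<phi> k' j' = (if k' = k then if j' = j then \<phi> k' j' else 0 else 0)"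
    if "k' \<in> {1..C n}" "j' < h n k'" for k' j'
  proof (cases "x \<in> lev n k' j'")
    case True
    then have "k' = k" "j' = j" using level_unique[OF assms that] by simp_all
    then show ?thesis using True by simp
  next
    case False
    then have "\<not> (k' = k \<and> j' = j)" using assms(3) by blast
    then show ?thesis using False by auto
  qed
  have "(\<Sum>k'\<in>{1..C n}. \<Sum>j'<h n k'. indicator (lev n k' j') x *\<^sub>R \<phi> k' j') =
      (\<Sum>k'\<in>{1..C n}. \<Sum>j'<h n k'. if k' = k then if j' = j then \<phi> k' j' else 0 else 0)"
    by (intro sum.cong refl) (use * in auto)
  also have "\<dots> = (\<Sum>k'\<in>{1..C n}. if k' = k then \<Sum>j'<h n k'. if j' = j then \<phi> k' j' else 0 else 0)"
    by (intro sum.cong refl) simp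
  also have "\<dots> = \<phi> k j" using assms(1,2) by (simp add: sum.delta)
  finally show ?thesis .
qed

lemma set_integrable_of_integrable:
  fixes \<phi> :: "'x \<Rightarrow> real"
  assumes "integrable \<mu> \<phi>" "A \<in> sets \<mu>"
  shows "set_integrable \<mu> A \<phi>"
  using integrable_mult_indicator[OF assms(2,1)] by (simp add: set_integrable_def)

lemma integral_levels:
  fixes F :: "'x \<Rightarrow> real" and \<phi> :: "nat \<Rightarrow> nat \<Rightarrow> 'x \<Rightarrow> real"
  assumes int: "\<And>k j. k \<in> {1..C n} \<Longrightarrow> j < h n k \<Longrightarrow> integrable \<mu> (\<phi> k j)"
    and F: "\<And>k j x. k \<in> {1..C n} \<Longrightarrow> j < h n k \<Longrightarrow> x \<in> lev n k j \<Longrightarrow> F x = \<phi> k j x"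
  shows "(\<integral>x. F x \<partial>\<mu>) = (\<Sum>k\<in>{1..C n}. \<Sum>j<h n k. LINT x:lev n k j|\<mu>. \<phi> k j x)"
proof -
  have "(\<integral>x. F x \<partial>\<mu>) =
      (\<integral>x. (\<Sum>k\<in>{1..C n}. \<Sum>j<h n k. indicator (lev n k j) x *\<^sub>R \<phi> k j x) \<partial>\<mu>)"
  proof (rule Bochner_Integration.integral_cong[OF refl])
    fix x assume "x \<in> space \<mu>"
    then have "x \<in> topspace X" by (simp add: space_\<mu>)
    then obtain k j where k: "k \<in> {1..C n}" "j < h n k" "x \<in> lev n k j" by (rule cover)
    show "F x = (\<Sum>k\<in>{1..C n}. \<Sum>j<h n k. indicator (lev n k j) x *\<^sub>R \<phi> k j x)"
      using sum_indicator_levels[OF k, of "\<lambda>k j. \<phi> k j x"] F[OF k] by simp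
  qed
  also have "\<dots> = (\<Sum>k\<in>{1..C n}. \<integral>x. (\<Sum>j<h n k. indicator (lev n k j) x *\<^sub>R \<phi> k j x) \<partial>\<mu>)"
    using int by (intro Bochner_Integration.integral_sum Bochner_Integration.integrable_sum
        integrable_mult_indicator level_sets) auto
  also have "\<dots> = (\<Sum>k\<in>{1..C n}. \<Sum>j<h n k. \<integral>x. indicator (lev n k j) x *\<^sub>R \<phi> k j x \<partial>\<mu>)"
    using int by (intro sum.cong refl Bochner_Integration.integral_sum
        integrable_mult_indicator level_sets) auto
  finally show ?thesis by (simp add: set_lebesgue_integral_def)
qed

lemma tower_mass: "(\<Sum>k\<in>{1..C n}. h n k * prob (B n k)) = 1"
proof -
  have "(1::real) = (\<integral>x. 1 \<partial>\<mu>)" by (simp add: prob_space)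
  also have "\<dots> = (\<Sum>k\<in>{1..C n}. \<Sum>j<h n k. LINT x:lev n k j|\<mu>. 1)"
    by (rule integral_levels) auto
  also have "\<dots> = (\<Sum>k\<in>{1..C n}. \<Sum>j<h n k. prob (B n k))"
    by (intro sum.cong refl) (simp add: set_lebesgue_integral_def prob_level level_sets)
  finally show ?thesis by simp
qed

text \<open>Every finer tower visits \<open>B n k\<close>, in levels that are pairwise disjoint, so
  this base has at least the mass of the whole finer base. Since the finer towers have total mass 1
  and heights at most \<open>L * h n k\<close>, no coarse tower has mass below
  \<open>1 / L\<close>.\<close>

lemma tower_mass_ge:
  fixes L :: real
  assumes L: "\<And>l. l \<in> {1..C (Suc n)} \<Longrightarrow> h (Suc n) l \<le> L * h n k" and k: "k \<in> {1..C n}"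
  shows "1 \<le> L * h n k * prob (B n k)"
proof -
  have "\<forall>l\<in>{1..C (Suc n)}. \<exists>j. j < h (Suc n) l \<and> lev (Suc n) l j \<subseteq> B n k"
    using visit_exists[OF _ k] by metis
  then obtain j where j: "\<And>l. l \<in> {1..C (Suc n)} \<Longrightarrow> j l < h (Suc n) l"
      "\<And>l. l \<in> {1..C (Suc n)} \<Longrightarrow> lev (Suc n) l (j l) \<subseteq> B n k"
    by metis
  have "disjoint_family_on (\<lambda>l. lev (Suc n) l (j l)) {1..C (Suc n)}"
    unfolding disjoint_family_on_def using level_unique(1) j(1) by blast
  then have "prob (\<Union>l\<in>{1..C (Suc n)}. lev (Suc n) l (j l)) = (\<Sum>l\<in>{1..C (Suc n)}. prob (lev (Suc n) l (j l)))"
    by (intro finite_measure_finite_Union) (auto intro!: level_sets)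
  moreover have "prob (\<Union>l\<in>{1..C (Suc n)}. lev (Suc n) l (j l)) \<le> prob (B n k)"
    using B_sets[OF k] by (intro finite_measure_mono UN_least j(2))
  ultimately have *: "(\<Sum>l\<in>{1..C (Suc n)}. prob (B (Suc n) l)) \<le> prob (B n k)"
    by (simp add: prob_level)
  have Lh: "0 \<le> L * h n k" using L[OF C_pos] by (rule order_trans[rotated]) simp
  have "1 = (\<Sum>l\<in>{1..C (Suc n)}. h (Suc n) l * prob (B (Suc n) l))" by (simp only: tower_mass)
  also have "\<dots> \<le> (\<Sum>l\<in>{1..C (Suc n)}. (L * h n k) * prob (B (Suc n) l))"
    using L by (intro sum_mono mult_right_mono) auto
  also have "\<dots> \<le> (L * h n k) * prob (B n k)"
    using * Lh by (simp add: sum_distrib_left[symmetric] mult_left_mono)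
  finally show ?thesis .
qed

lemma AE_shift: "AE x in \<mu>. P x \<Longrightarrow> AE x in \<mu>. P (T x)"
  by (rule AE_distrD[OF T_measurable, of P, unfolded T_invariant])

lemma AE_eigen_funpow:
  fixes f :: "'x \<Rightarrow> complex"
  assumes "AE x in \<mu>. f (T x) = \<zeta> * f x"
  shows "AE x in \<mu>. f ((T ^^ j) x) = \<zeta> ^ j * f x"
proof (induction j)
  case (Suc j)
  from AE_shift[OF Suc] assms show ?case
    by eventually_elim (simp add: funpow_swap1)
qed simp

subsection \<open>Density of the functions that are constant on the levels\<close>

definition level_constant :: "nat \<Rightarrow> ('x \<Rightarrow> complex) \<Rightarrow> bool" where
  "level_constant n s \<longleftrightarrow> (\<forall>k\<in>{1..C n}. \<forall>j<h n k. \<exists>c. \<forall>x\<in>lev n k j. s x = c)"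

text \<open>The class is closed under sums, multiples and dominated limits, as induction over
  integrable functions requires. Integrability of \<open>s\<close> comes for free: a level-constant
  function takes finitely many values, on measurable pieces.\<close>

definition approximable :: "('x \<Rightarrow> complex) \<Rightarrow> bool" where
  "approximable f \<longleftrightarrow> integrable \<mu> f \<and>
     (\<forall>\<epsilon>>0. \<exists>n s. level_constant n s \<and> (\<integral>x. cmod (f x - s x) \<partial>\<mu>) < \<epsilon>)"

lemma level_refines_le:
  assumes "n \<le> m" "l \<in> {1..C m}" "j < h m l"
  obtains k i where "k \<in> {1..C n}" "i < h n k" "lev m l j \<subseteq> lev n k i"
proof -
  have "\<exists>k i. k \<in> {1..C n} \<and> i < h n k \<and> lev m l j \<subseteq> lev n k i"
    using assms
  proof (induction m arbitrary: l j rule: dec_induct)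
    case (step m)
    from level_refines[OF step.prems] obtain l' j'
      where "l' \<in> {1..C m}" "j' < h m l'" "lev (Suc m) l j \<subseteq> lev m l' j'" .
    then show ?case using step.IH by (meson subset_trans)
  qed blast
  then show ?thesis using that by blast
qed

lemma level_constant_mono:
  assumes "n \<le> m" "level_constant n s" shows "level_constant m s"
  unfolding level_constant_def
proof (intro ballI allI impI)
  fix l j assume "l \<in> {1..C m}" "j < h m l"
  then obtain k i where "k \<in> {1..C n}" "i < h n k" "lev m l j \<subseteq> lev n k i"
    using level_refines_le[OF assms(1)] by blast
  then show "\<exists>c. \<forall>x\<in>lev m l j. s x = c" using assms(2) unfolding level_constant_def by blast
qed

lemma level_constant_comp2:
  assumes "level_constant n s" "level_constant n t"
  shows "level_constant n (\<lambda>x. \<psi> (s x) (t x))"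
  using assms unfolding level_constant_def by metis

lemma level_constant_values:
  assumes "level_constant n s"
  obtains c where "\<And>k j x. k \<in> {1..C n} \<Longrightarrow> j < h n k \<Longrightarrow> x \<in> lev n k j \<Longrightarrow> s x = c k j"
  using assms unfolding level_constant_def by metis

lemma level_constant_integrable:
  assumes "level_constant n s" shows "integrable \<mu> s"
proof -
  obtain c where c: "\<And>k j x. k \<in> {1..C n} \<Longrightarrow> j < h n k \<Longrightarrow> x \<in> lev n k j \<Longrightarrow> s x = c k j"
    using level_constant_values[OF assms] by blast
  have int: "integrable \<mu> (\<lambda>x. \<Sum>k\<in>{1..C n}. \<Sum>j<h n k. indicator (lev n k j) x *\<^sub>R c k j)"
    by (intro Bochner_Integration.integrable_sum integrable_mult_indicator level_sets) auto
  have eq: "s x = (\<Sum>k\<in>{1..C n}. \<Sum>j<h n k. indicator (lev n k j) x *\<^sub>R c k j)"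
    if "x \<in> space \<mu>" for x
  proof -
    have "x \<in> topspace X" using that by (simp add: space_\<mu>)
    then obtain k j where k: "k \<in> {1..C n}" "j < h n k" "x \<in> lev n k j" by (rule cover)
    then show ?thesis using sum_indicator_levels[OF k, of c] c by simp
  qed
  show ?thesis by (rule Bochner_Integration.integrable_cong[OF refl eq, THEN iffD2, OF _ int])
qed

lemma approximable_level_constant:
  assumes "level_constant n s" shows "approximable s"
  unfolding approximable_def
proof (intro conjI allI impI)
  show "integrable \<mu> s" by (rule level_constant_integrable[OF assms])
  show "\<exists>n t. level_constant n t \<and> (\<integral>x. cmod (s x - t x) \<partial>\<mu>) < \<epsilon>" if "0 < \<epsilon>" for \<epsilon>
    using assms that by (intro exI[of _ n] exI[of _ s]) simp
qed

lemma approximable_cong: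
  assumes "approximable f" "\<And>x. x \<in> space \<mu> \<Longrightarrow> f x = g x"
  shows "approximable g"
proof -
  have "integrable \<mu> f = integrable \<mu> g"
    by (rule Bochner_Integration.integrable_cong[OF refl assms(2)])
  moreover have "(\<integral>x. cmod (f x - s x) \<partial>\<mu>) = (\<integral>x. cmod (g x - s x) \<partial>\<mu>)" for s
    by (rule Bochner_Integration.integral_cong[OF refl]) (simp add: assms(2))
  ultimately show ?thesis using assms(1) by (simp add: approximable_def)
qed

lemma approximable_add:
  assumes "approximable f" "approximable g"
  shows "approximable (\<lambda>x. f x + g x)"
  unfolding approximable_def
proof (intro conjI allI impI)
  have i: "integrable \<mu> f" "integrable \<mu> g" using assms by (auto simp: approximable_def)
  then show "integrable \<mu> (\<lambda>x. f x + g x)" by simp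
  fix \<epsilon> :: real assume "0 < \<epsilon>"
  then have "0 < \<epsilon>/2" by simp
  then obtain n s m t where s: "level_constant n s" "(\<integral>x. cmod (f x - s x) \<partial>\<mu>) < \<epsilon>/2"
    and t: "level_constant m t" "(\<integral>x. cmod (g x - t x) \<partial>\<mu>) < \<epsilon>/2"
    using assms unfolding approximable_def by meson
  have "level_constant (max n m) s" "level_constant (max n m) t"
    using s t level_constant_mono by (meson max.cobounded1 max.cobounded2)+
  then have "level_constant (max n m) (\<lambda>x. s x + t x)"
    by (rule level_constant_comp2)
  moreover have "(\<integral>x. cmod (f x + g x - (s x + t x)) \<partial>\<mu>) < \<epsilon>"
  proof -
    have j: "integrable \<mu> s" "integrable \<mu> t" using s t level_constant_integrable by auto
    have "(\<integral>x. cmod (f x + g x - (s x + t x)) \<partial>\<mu>) \<le> (\<integral>x. cmod (f x - s x) + cmod (g x - t x) \<partial>\<mu>)"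
      using i j by (intro integral_mono) (auto simp: norm_diff_triangle_ineq)
    also have "\<dots> = (\<integral>x. cmod (f x - s x) \<partial>\<mu>) + (\<integral>x. cmod (g x - t x) \<partial>\<mu>)"
      using i j by simp
    finally show ?thesis using s t by simp
  qed
  ultimately show "\<exists>n s. level_constant n s \<and> (\<integral>x. cmod (f x + g x - s x) \<partial>\<mu>) < \<epsilon>" by blast
qed

lemma approximable_cmult:
  assumes "approximable f" shows "approximable (\<lambda>x. a * f x)"
  unfolding approximable_def
proof (intro conjI allI impI)
  show "integrable \<mu> (\<lambda>x. a * f x)" using assms by (simp add: approximable_def)
  fix \<epsilon> :: real assume e: "0 < \<epsilon>"
  have "0 < \<epsilon> / (cmod a + 1)" using e by (simp add: add_nonneg_pos)
  then obtain n s where s: "level_constant n s" "(\<integral>x. cmod (f x - s x) \<partial>\<mu>) < \<epsilon> / (cmod a + 1)"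
    using assms unfolding approximable_def by blast
  have "level_constant n (\<lambda>x. a * s x)" using level_constant_comp2[OF s(1) s(1), of "\<lambda>u v. a * u"] .
  moreover have "(\<integral>x. cmod (a * f x - a * s x) \<partial>\<mu>) < \<epsilon>"
  proof -
    have "(\<integral>x. cmod (a * f x - a * s x) \<partial>\<mu>) = cmod a * (\<integral>x. cmod (f x - s x) \<partial>\<mu>)"
      by (simp add: right_diff_distrib[symmetric] norm_mult)
    also have "\<dots> \<le> (cmod a + 1) * (\<integral>x. cmod (f x - s x) \<partial>\<mu>)"
      by (intro mult_right_mono) auto
    also have "\<dots> < \<epsilon>" using s(2) by (simp add: pos_less_divide_eq add_nonneg_pos mult.commute)
    finally show ?thesis .
  qed
  ultimately show "\<exists>n s. level_constant n s \<and> (\<integral>x. cmod (a * f x - s x) \<partial>\<mu>) < \<epsilon>" by blast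
qed

lemma approximable_limit:
  fixes w :: "'x \<Rightarrow> real"
  assumes s: "\<And>i. approximable (s i)" and f: "integrable \<mu> f" and w: "integrable \<mu> w"
    and lim: "\<And>x. x \<in> space \<mu> \<Longrightarrow> (\<lambda>i. s i x) \<longlonglongrightarrow> f x"
    and bound: "\<And>i x. x \<in> space \<mu> \<Longrightarrow> cmod (s i x) \<le> w x"
  shows "approximable f"
  unfolding approximable_def
proof (intro conjI allI impI)
  have si: "integrable \<mu> (s i)" for i using s by (simp add: approximable_def)
  have "(\<lambda>i. \<integral>x. cmod (f x - s i x) \<partial>\<mu>) \<longlonglongrightarrow> (\<integral>x. 0 \<partial>\<mu>)"
  proof (rule integral_dominated_convergence)
    show "integrable \<mu> (\<lambda>x. cmod (f x) + w x)" using f w by simp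
    show "AE x in \<mu>. (\<lambda>i. cmod (f x - s i x)) \<longlonglongrightarrow> 0"
    proof (rule AE_I2)
      fix x assume "x \<in> space \<mu>"
      then have "(\<lambda>i. cmod (f x - s i x)) \<longlonglongrightarrow> cmod (f x - f x)"
        using lim by (intro tendsto_intros) auto
      then show "(\<lambda>i. cmod (f x - s i x)) \<longlonglongrightarrow> 0" by simp
    qed
    show "AE x in \<mu>. norm (cmod (f x - s i x)) \<le> cmod (f x) + w x" for i
      using bound by (intro AE_I2) (smt (verit) norm_triangle_ineq4 real_norm_def abs_norm_cancel)
  qed (use f si in auto)
  then have lim0: "(\<lambda>i. \<integral>x. cmod (f x - s i x) \<partial>\<mu>) \<longlonglongrightarrow> 0" by simp
  show "integrable \<mu> f" by (rule f)
  fix \<epsilon> :: real assume "0 < \<epsilon>"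
  then have e: "0 < \<epsilon>/2" by simp
  from eventually_happens'[OF sequentially_bot order_tendstoD(2)[OF lim0 e]]
  obtain i where i: "(\<integral>x. cmod (f x - s i x) \<partial>\<mu>) < \<epsilon>/2" ..
  obtain n t where t: "level_constant n t" "(\<integral>x. cmod (s i x - t x) \<partial>\<mu>) < \<epsilon>/2"
    using s[of i] e unfolding approximable_def by blast
  have ti: "integrable \<mu> t" using level_constant_integrable t by blast
  have "(\<integral>x. cmod (f x - t x) \<partial>\<mu>) \<le> (\<integral>x. cmod (f x - s i x) + cmod (s i x - t x) \<partial>\<mu>)"
    using f si ti by (intro integral_mono) (auto intro: order_trans[OF _ norm_triangle_ineq])
  also have "\<dots> = (\<integral>x. cmod (f x - s i x) \<partial>\<mu>) + (\<integral>x. cmod (s i x - t x) \<partial>\<mu>)"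
    using f si ti by simp
  finally show "\<exists>n s. level_constant n s \<and> (\<integral>x. cmod (f x - s x) \<partial>\<mu>) < \<epsilon>"
    using i t by (intro exI[of _ n] exI[of _ t]) auto
qed

definition levels :: "'x set set" where
  "levels = (\<Union>n. tower_partition X T (C n) (B n) (h n))"

lemma levels_iff: "A \<in> levels \<longleftrightarrow> (\<exists>n k j. k \<in> {1..C n} \<and> j < h n k \<and> A = lev n k j)"
  by (force simp: levels_def tower_partition_def tower_indices_def)

text \<open>Later partitions refine earlier ones, so the levels form a tree under inclusion.\<close>

lemma levels_nested:
  assumes "P \<in> levels" "Q \<in> levels"
  shows "P \<inter> Q = {} \<or> P \<subseteq> Q \<or> Q \<subseteq> P"
proof -
  have *: "lev n k j \<inter> lev m l i = {} \<or> lev m l i \<subseteq> lev n k j"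
    if nm: "n \<le> m" and k: "k \<in> {1..C n}" "j < h n k" and l: "l \<in> {1..C m}" "i < h m l" for n m k j l i
  proof -
    obtain k' j' where k': "k' \<in> {1..C n}" "j' < h n k'" "lev m l i \<subseteq> lev n k' j'"
      using level_refines_le[OF nm l] .
    then show ?thesis using level_unique[OF k _ k'(1,2)] by blast
  qed
  obtain n k j where P: "k \<in> {1..C n}" "j < h n k" "P = lev n k j" using assms levels_iff by blast
  obtain m l i where Q: "l \<in> {1..C m}" "i < h m l" "Q = lev m l i" using assms levels_iff by blast
  show ?thesis using *[of n m k j l i] *[of m n l i k j] P Q by (metis inf_commute nat_le_linear)
qed

text \<open>(KR4) only makes the levels a subbase; as any two of them are nested or disjoint, finite
  intersections add nothing and they form a base.\<close>

lemma openin_levels: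
  assumes "openin X U" "x \<in> U"
  obtains P where "P \<in> levels" "x \<in> P" "P \<subseteq> U"
proof -
  have "X = topology_generated_by levels"
    using LR unfolding LR_partition_sequence_def levels_def by (elim conjE)
  then have "openin (topology_generated_by levels) U" using assms(1) by simp
  then have "generate_topology_on levels U" by (rule openin_topology_generated_by)
  then have "\<forall>x\<in>U. \<exists>P\<in>levels. x \<in> P \<and> P \<subseteq> U"
  proof induction
    case (Int a b)
    show ?case
    proof
      fix x assume x: "x \<in> a \<inter> b"
      then obtain P Q where "P \<in> levels" "Q \<in> levels" "x \<in> P" "x \<in> Q" "P \<subseteq> a" "Q \<subseteq> b"
        using Int.IH by blast
      then show "\<exists>P\<in>levels. x \<in> P \<and> P \<subseteq> a \<inter> b" using levels_nested[of P Q] by blast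
    qed
  next
    case (UN K)
    show ?case
    proof
      fix x assume "x \<in> \<Union>K"
      then obtain k where "k \<in> K" "x \<in> k" by blast
      then obtain P where "P \<in> levels" "x \<in> P" "P \<subseteq> k" using UN.IH by blast
      then show "\<exists>P\<in>levels. x \<in> P \<and> P \<subseteq> \<Union>K" using \<open>k \<in> K\<close> by blast
    qed
  qed auto
  then show ?thesis using that assms(2) by blast
qed

lemma countable_levels: "countable levels"
  unfolding levels_def tower_partition_def tower_indices_def by (intro countable_UN countable_image) auto

text \<open>There are countably many levels, so every open set is a countable union of them. The
  empty set is added to make the generator closed under intersection.\<close>

lemma sets_eq_sigma_levels: "sets \<mu> = sigma_sets (topspace X) (insert {} levels)"
  unfolding sets_\<mu> sets_measure_of[OF openin_Pow]
proof (rule sigma_sets_eqI)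
  fix U assume "U \<in> {U. openin X U}"
  then have "U = \<Union>{P \<in> levels. P \<subseteq> U}" using openin_levels by blast
  moreover have "\<Union>{P \<in> levels. P \<subseteq> U} \<in> sigma_sets (topspace X) (insert {} levels)"
    using countable_levels by (intro sigma_sets_UNION) (auto intro: countable_subset)
  ultimately show "U \<in> sigma_sets (topspace X) (insert {} levels)" by simp
next
  fix P assume "P \<in> insert {} levels"
  then have "openin X P" using openin_level by (auto simp: levels_iff)
  then show "P \<in> sigma_sets (topspace X) {U. openin X U}" by auto
qed

text \<open>Dynkin's argument from an intersection-stable generator: complements follow by
  linearity, disjoint unions by finite sums and a dominated limit.\<close>

lemma approximable_indicator:
  assumes "A \<in> sets \<mu>"
  shows "approximable (\<lambda>x. of_real (indicator A x))"
proof -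
  have stable: "Int_stable (insert {} levels)"
  proof (rule Int_stableI)
    fix P Q assume "P \<in> insert {} levels" "Q \<in> insert {} levels"
    then consider "P \<inter> Q = {}" | "P \<subseteq> Q" | "Q \<subseteq> P" using levels_nested by blast
    then show "P \<inter> Q \<in> insert {} levels"
      using \<open>P \<in> _\<close> \<open>Q \<in> _\<close> by cases (simp_all add: Int_absorb1 Int_absorb2)
  qed
  have sub: "insert {} levels \<subseteq> Pow (topspace X)" using level_subset by (fastforce simp: levels_iff)
  have empty: "approximable (\<lambda>x. of_real (indicator {} x))"
    by (rule approximable_level_constant[of 0]) (auto simp: level_constant_def)
  from stable sub assms[unfolded sets_eq_sigma_levels] show ?thesis
  proof (induction rule: sigma_sets_induct_disjoint)
    case (basic A)
    show ?case
    proof (cases "A = {}")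
      case False
      then obtain n k j where A: "k \<in> {1..C n}" "j < h n k" "A = lev n k j"
        using basic levels_iff by blast
      have "level_constant n (\<lambda>x. of_real (indicator A x))"
        unfolding level_constant_def
      proof (intro ballI allI impI)
        fix k' j' assume k': "k' \<in> {1..C n}" "j' < h n k'"
        show "\<exists>c. \<forall>x\<in>lev n k' j'. complex_of_real (indicator A x) = c"
        proof (cases "k' = k \<and> j' = j")
          case False
          then have "x \<notin> A" if "x \<in> lev n k' j'" for x
            using level_unique[OF k' that A(1,2)] A(3) by blast
          then show ?thesis by auto
        qed (use A in auto)
      qed
      then show ?thesis by (rule approximable_level_constant)
    qed (use empty in simp)
  next
    case empty
    show ?case by fact
  next
    case (compl A)
    have one: "approximable (\<lambda>_. 1)"
      by (rule approximable_level_constant[of 0]) (auto simp: level_constant_def)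
    have "approximable (\<lambda>x. 1 + (-1) * of_real (indicator A x))"
      by (rule approximable_add[OF one approximable_cmult[OF compl(2)]])
    then show ?case by (rule approximable_cong) (simp add: indicator_def space_\<mu>)
  next
    case (union A)
    have Am: "A i \<in> sets \<mu>" for i using union sets_eq_sigma_levels by auto
    have "approximable (\<lambda>x. of_real (indicator (\<Union>i<n. A i) x))" for n
    proof (induction n)
      case (Suc n)
      have disj: "x \<notin> A i" if "x \<in> A n" "i < n" for x i
        using disjoint_family_onD[OF union(1), of n i] that by auto
      have "(\<Union>i<Suc n. A i) = (\<Union>i<n. A i) \<union> A n" by (auto simp: less_Suc_eq)
      then have "of_real (indicator (\<Union>i<n. A i) x) + of_real (indicator (A n) x) =
          complex_of_real (indicator (\<Union>i<Suc n. A i) x)" for x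
        using disj[of x] by (simp add: indicator_def)
      then show ?case using approximable_add[OF Suc union(3)[of n]] by (simp only:)
    qed (use empty in simp)
    then show ?case
    proof (rule approximable_limit)
      show "integrable \<mu> (\<lambda>x. complex_of_real (indicator (\<Union>(range A)) x))"
        using Am by (intro integrable_of_real integrable_real_indicator) (auto simp: emeasure_eq_measure)
      show "(\<lambda>n. complex_of_real (indicator (\<Union>i<n. A i) x)) \<longlonglongrightarrow> complex_of_real (indicator (\<Union>(range A)) x)" for x
        by (intro tendsto_of_real LIMSEQ_indicator_UN)
      show "cmod (complex_of_real (indicator (\<Union>i<n. A i) x)) \<le> 1" for n x
        by (simp add: indicator_def)
    qed simp
  qed
qed

lemma approximable_integrable:
  assumes "integrable \<mu> f" shows "approximable f"
  using assms
proof (induction rule: integrable_induct)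
  case (base A c)
  then show ?case
    using approximable_cmult[OF approximable_indicator[of A], of c]
    by (simp add: scaleR_conv_of_real mult.commute)
next
  case (add f g)
  then show ?case by (intro approximable_add)
next
  case (lim f s)
  \<comment> \<open>The induction rule supplies integrable functions \<open>s i\<close> whose norms
    are at most twice that of \<open>f\<close>.\<close>
  then show ?case
    by (intro approximable_limit[of s f "\<lambda>x. 2 * cmod (f x)"]) auto
qed

subsection \<open>Eigenfunctions on the towers\<close>

text \<open>Invariance of \<open>\<mu>\<close> carries the error on the \<open>j\<close>-th level to
  the base and only multiplies the constant by \<open>\<zeta> ^ j\<close>. A base has mass of order
  \<open>1 / h n k\<close>, so the weight \<open>h n k\<close> puts the error at the scale of a
  whole tower.\<close>

lemma tower_constants:
  assumes f: "integrable \<mu> f" and eig: "AE x in \<mu>. f (T x) = \<zeta> * f x" and \<zeta>: "cmod \<zeta> = 1"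
    and e: "0 < \<epsilon>"
  obtains n0 where "\<And>n. n \<ge> n0 \<Longrightarrow>
    \<exists>d. (\<Sum>k\<in>{1..C n}. h n k * (LINT x:B n k|\<mu>. cmod (f x - d k))) \<le> \<epsilon>"
proof -
  obtain n0 s where s: "level_constant n0 s" "(\<integral>x. cmod (f x - s x) \<partial>\<mu>) < \<epsilon>"
    using approximable_integrable[OF f] e unfolding approximable_def by blast
  show ?thesis
  proof
    fix n assume "n \<ge> n0"
    then have "level_constant n s" using s level_constant_mono by blast
    then obtain c where c: "\<And>k j x. k \<in> {1..C n} \<Longrightarrow> j < h n k \<Longrightarrow> x \<in> lev n k j \<Longrightarrow> s x = c k j"
      by (rule level_constant_values) blast
    define a where "a k j = (LINT x:B n k|\<mu>. cmod (f x - \<zeta> ^ j * c k j))" for k j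
    have lev_a: "(LINT x:lev n k j|\<mu>. cmod (f x - c k j)) = a k j" if k: "k \<in> {1..C n}" for k j
    proof -
      note [measurable] = borel_measurable_integrable[OF f]
      have "(LINT x:lev n k j|\<mu>. cmod (f x - c k j)) =
          (LINT x:lev n k j|\<mu>. cmod (f ((T ^^ j) x) - \<zeta> ^ j * c k j))"
        unfolding set_lebesgue_integral_def
      proof (rule integral_cong_AE)
        show "AE x in \<mu>. indicator (lev n k j) x *\<^sub>R cmod (f x - c k j) =
            indicator (lev n k j) x *\<^sub>R cmod (f ((T ^^ j) x) - \<zeta> ^ j * c k j)"
          using AE_eigen_funpow[OF eig, of j]
          by eventually_elim (simp add: right_diff_distrib[symmetric] norm_mult norm_power \<zeta>)
      qed (use level_sets[OF k] in measurable)
      also have "\<dots> = a k j"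
        unfolding a_def by (rule integral_level[where \<phi> = "\<lambda>x. cmod (f x - \<zeta> ^ j * c k j)"]) (use k in measurable)
      finally show ?thesis .
    qed
    have "(\<integral>x. cmod (f x - s x) \<partial>\<mu>) = (\<Sum>k\<in>{1..C n}. \<Sum>j<h n k. LINT x:lev n k j|\<mu>. cmod (f x - c k j))"
      using f c by (intro integral_levels) auto
    then have sum_a: "(\<Sum>k\<in>{1..C n}. \<Sum>j<h n k. a k j) < \<epsilon>" using s(2) lev_a by simp
    \<comment> \<open>In each tower the constant of the best level, transported to the base, serves for all levels.\<close>
    have "\<forall>k\<in>{1..C n}. \<exists>j. h n k * a k j \<le> (\<Sum>j<h n k. a k j)"
      using exists_below_average h_pos by metis
    then obtain j where j: "\<And>k. k \<in> {1..C n} \<Longrightarrow> h n k * a k (j k) \<le> (\<Sum>j<h n k. a k j)"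
      by metis
    have "(\<Sum>k\<in>{1..C n}. h n k * a k (j k)) \<le> \<epsilon>"
      using sum_mono[OF j, of "{1..C n}" "\<lambda>k. k"] sum_a by simp
    then show "\<exists>d. (\<Sum>k\<in>{1..C n}. h n k * (LINT x:B n k|\<mu>. cmod (f x - d k))) \<le> \<epsilon>"
      by (intro exI[of _ "\<lambda>k. \<zeta> ^ j k * c k (j k)"]) (simp add: a_def)
  qed
qed

lemma integral_mono_set:
  fixes \<phi> :: "'x \<Rightarrow> real"
  assumes "integrable \<mu> \<phi>" "\<And>x. 0 \<le> \<phi> x" "A \<subseteq> A'" "A \<in> sets \<mu>" "A' \<in> sets \<mu>"
  shows "(LINT x:A|\<mu>. \<phi> x) \<le> (LINT x:A'|\<mu>. \<phi> x)"
  unfolding set_lebesgue_integral_def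
  using assms by (intro integral_mono integrable_mult_indicator) (auto simp: indicator_def)

lemma tower_term_le:
  fixes d :: "nat \<Rightarrow> complex"
  assumes "(\<Sum>k\<in>{1..C n}. h n k * (LINT x:B n k|\<mu>. cmod (f x - d k))) \<le> \<epsilon>" "k \<in> {1..C n}"
  shows "h n k * (LINT x:B n k|\<mu>. cmod (f x - d k)) \<le> \<epsilon>"
proof -
  have "h n k * (LINT x:B n k|\<mu>. cmod (f x - d k)) \<le>
      (\<Sum>k\<in>{1..C n}. h n k * (LINT x:B n k|\<mu>. cmod (f x - d k)))"
    using assms(2) by (intro member_le_sum) (auto simp: set_lebesgue_integral_def intro!: mult_nonneg_nonneg integral_nonneg_AE)
  then show ?thesis using assms(1) by simp
qed

text \<open>On \<open>?D\<close> the function is close to \<open>d\<close> and, multiplied by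
  \<open>\<zeta> ^ j\<close>, close to \<open>d'\<close>, with errors \<open>a\<close> and
  \<open>a'\<close>. By \<open>tower_mass_ge\<close> the mass of \<open>?D\<close> is at least
  \<open>1 / (L * h (Suc n) l)\<close>; dividing by it leaves \<open>L\<^sup>2 * \<epsilon>\<close>
  from \<open>a\<close>, because \<open>h (Suc n) l \<le> L * h n k\<close>, and
  \<open>L * \<epsilon>\<close> from \<open>a'\<close>. The index \<open>j\<close> is not bounded by
  the height of the tower: the case \<open>j = h (Suc n) l\<close> yields the information on
  eigenvalues.\<close>

lemma tower_constants_close:
  fixes d d' :: complex and L :: real
  assumes f: "integrable \<mu> f" and eig: "AE x in \<mu>. f (T x) = \<zeta> * f x" and \<zeta>: "cmod \<zeta> = 1"
    and L: "0 < L" "\<And>n l k. l \<in> {1..C (Suc n)} \<Longrightarrow> k \<in> {1..C n} \<Longrightarrow> h (Suc n) l \<le> L * h n k"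
    and k: "k \<in> {1..C n}" and l: "l \<in> {1..C (Suc n)}" and j: "lev (Suc n) l j \<subseteq> B n k"
    and d: "h n k * (LINT x:B n k|\<mu>. cmod (f x - d)) \<le> \<epsilon>"
    and d': "h (Suc n) l * (LINT x:B (Suc n) l|\<mu>. cmod (f x - d')) \<le> \<epsilon>"
  shows "cmod (\<zeta> ^ j * d - d') \<le> (L\<^sup>2 + L) * \<epsilon>"
proof -
  note [measurable] = borel_measurable_integrable[OF f]
  let ?D = "lev (Suc n) l j" and ?m = "prob (B (Suc n) l)"
  define a where "a = (LINT x:B n k|\<mu>. cmod (f x - d))"
  define a' where "a' = (LINT x:B (Suc n) l|\<mu>. cmod (f x - d'))"
  have a_nonneg: "0 \<le> a" "0 \<le> a'"
    by (auto simp: a_def a'_def set_lebesgue_integral_def intro!: integral_nonneg_AE)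
  have D: "?D \<in> sets \<mu>" using level_sets[OF l] .
  have "?m * cmod (\<zeta> ^ j * d - d') = (LINT x:?D|\<mu>. cmod (\<zeta> ^ j * d - d'))"
    using D prob_level[OF l, of j] by (simp add: set_lebesgue_integral_def)
  also have "\<dots> \<le> (LINT x:?D|\<mu>. cmod (f x - d) + cmod (\<zeta> ^ j * f x - d'))"
  proof (rule set_integral_mono)
    fix x
    have "cmod (\<zeta> ^ j * d - d') \<le> cmod (\<zeta> ^ j * (d - f x)) + cmod (\<zeta> ^ j * f x - d')"
      by (rule order_trans[OF _ norm_triangle_ineq]) (simp add: algebra_simps)
    then show "cmod (\<zeta> ^ j * d - d') \<le> cmod (f x - d) + cmod (\<zeta> ^ j * f x - d')"
      by (simp add: norm_mult norm_power \<zeta> norm_minus_commute)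
  qed (use f D in \<open>auto intro!: set_integrable_of_integrable\<close>)
  also have "\<dots> = (LINT x:?D|\<mu>. cmod (f x - d)) + (LINT x:?D|\<mu>. cmod (\<zeta> ^ j * f x - d'))"
    using f D by (intro set_integral_add set_integrable_of_integrable) auto
  also have "(LINT x:?D|\<mu>. cmod (f x - d)) \<le> a"
    unfolding a_def using f j D B_sets[OF k] by (intro integral_mono_set) auto
  also have "(LINT x:?D|\<mu>. cmod (\<zeta> ^ j * f x - d')) = (LINT x:?D|\<mu>. cmod (f ((T ^^ j) x) - d'))"
    unfolding set_lebesgue_integral_def
  proof (rule integral_cong_AE)
    show "AE x in \<mu>. indicator ?D x *\<^sub>R cmod (\<zeta> ^ j * f x - d') =
        indicator ?D x *\<^sub>R cmod (f ((T ^^ j) x) - d')"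
      using AE_eigen_funpow[OF eig, of j] by eventually_elim simp
  qed (use D in measurable)
  also have "\<dots> = a'"
    unfolding a'_def by (rule integral_level[where \<phi> = "\<lambda>x. cmod (f x - d')"]) (use l in measurable)
  finally have m: "?m * cmod (\<zeta> ^ j * d - d') \<le> a + a'" by simp
  have "1 * cmod (\<zeta> ^ j * d - d') \<le> (L * h (Suc n) l * ?m) * cmod (\<zeta> ^ j * d - d')"
    using tower_mass_ge[of "Suc n" L l] L l by (intro mult_right_mono) auto
  also have "\<dots> = L * h (Suc n) l * (?m * cmod (\<zeta> ^ j * d - d'))" by simp
  also have "\<dots> \<le> L * h (Suc n) l * (a + a')"
    using m L by (intro mult_left_mono) auto
  also have "\<dots> = L * (h (Suc n) l * a) + L * (h (Suc n) l * a')" by (simp add: algebra_simps)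
  also have "h (Suc n) l * a \<le> L * (h n k * a)"
    using mult_right_mono[OF L(2)[OF l k] a_nonneg(1)] by (simp add: mult.assoc)
  also have "h n k * a \<le> \<epsilon>" using d by (simp add: a_def)
  also have "h (Suc n) l * a' \<le> \<epsilon>" using d' by (simp add: a'_def)
  finally show ?thesis using L by (simp add: power2_eq_square algebra_simps)
qed

section \<open>Ergodicity and the powers of an eigenvalue\<close>

lemma integral_towers_invariant:
  fixes \<phi> :: "'x \<Rightarrow> real"
  assumes \<phi>: "integrable \<mu> \<phi>" and inv: "AE x in \<mu>. \<phi> (T x) = \<phi> x"
  shows "(\<integral>x. \<phi> x \<partial>\<mu>) = (\<Sum>k\<in>{1..C n}. h n k * (LINT x:B n k|\<mu>. \<phi> x))"
proof -
  note [measurable] = borel_measurable_integrable[OF \<phi>]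
  have inv_pow: "AE x in \<mu>. \<phi> ((T ^^ j) x) = \<phi> x" for j
  proof (induction j)
    case (Suc j)
    from AE_shift[OF Suc] inv show ?case by eventually_elim (simp add: funpow_swap1)
  qed simp
  have "(LINT x:lev n k j|\<mu>. \<phi> x) = (LINT x:B n k|\<mu>. \<phi> x)" if k: "k \<in> {1..C n}" for k j
  proof -
    have "(LINT x:lev n k j|\<mu>. \<phi> x) = (LINT x:lev n k j|\<mu>. \<phi> ((T ^^ j) x))"
      unfolding set_lebesgue_integral_def
    proof (rule integral_cong_AE)
      show "AE x in \<mu>. indicator (lev n k j) x *\<^sub>R \<phi> x = indicator (lev n k j) x *\<^sub>R \<phi> ((T ^^ j) x)"
        using inv_pow[of j] by eventually_elim simp
    qed (use level_sets[OF k] in measurable)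
    also have "\<dots> = (LINT x:B n k|\<mu>. \<phi> x)" by (rule integral_level) (use k in measurable)
    finally show ?thesis .
  qed
  then show ?thesis
    using integral_levels[of n "\<lambda>_ _. \<phi>" \<phi>] \<phi> by simp
qed

text \<open>For the eigenvalue 1 no power of \<open>\<zeta>\<close> separates the constants: tower 1
  of the partition \<open>Suc n\<close> visits every \<open>B n k\<close>, so all \<open>d k\<close>
  are close to \<open>d' 1\<close>, and \<open>f\<close> is L1-close to a single constant.\<close>

lemma invariant_function_constant:
  fixes f :: "'x \<Rightarrow> complex"
  assumes f: "integrable \<mu> f" and inv: "AE x in \<mu>. f (T x) = f x"
  shows "AE x in \<mu>. f x = (\<integral>x. f x \<partial>\<mu>)"
proof -
  obtain L :: real where L: "0 < L"
    "\<And>n l k. l \<in> {1..C (Suc n)} \<Longrightarrow> k \<in> {1..C n} \<Longrightarrow> h (Suc n) l \<le> L * h n k"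
    using linear_growth by blast
  have inv1: "AE x in \<mu>. f (T x) = 1 * f x" using inv by simp
  \<comment> \<open>The 1 pays for approximating \<open>f\<close> by \<open>d k\<close> on the
    towers, \<open>L\<^sup>2 + L\<close> for replacing every \<open>d k\<close> by
    \<open>d' 1\<close>.\<close>
  define K where "K = 1 + (L\<^sup>2 + L)"
  have K: "0 < K" using L(1) by (simp add: K_def add_pos_nonneg)
  define I where "I = (\<integral>x. f x \<partial>\<mu>)"
  have near: "(\<integral>x. cmod (f x - I) \<partial>\<mu>) \<le> 2 * (K * \<epsilon>)" if e: "0 < \<epsilon>" for \<epsilon> :: real
  proof -
    obtain n where n: "\<And>m. m \<ge> n \<Longrightarrow> \<exists>d. (\<Sum>k\<in>{1..C m}. h m k * (LINT x:B m k|\<mu>. cmod (f x - d k))) \<le> \<epsilon>"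
      using tower_constants[OF f inv1 _ e] by auto
    obtain d where d: "(\<Sum>k\<in>{1..C n}. h n k * (LINT x:B n k|\<mu>. cmod (f x - d k))) \<le> \<epsilon>"
      using n[of n] by auto
    obtain d' where d': "(\<Sum>k\<in>{1..C (Suc n)}. h (Suc n) k * (LINT x:B (Suc n) k|\<mu>. cmod (f x - d' k))) \<le> \<epsilon>"
      using n[of "Suc n"] by auto
    have close: "cmod (d k - d' 1) \<le> (L\<^sup>2 + L) * \<epsilon>" if k: "k \<in> {1..C n}" for k
    proof -
      obtain j where "lev (Suc n) 1 j \<subseteq> B n k" using visit_exists[OF C_pos k] by blast
      from tower_constants_close[OF f inv1 _ L k C_pos this tower_term_le[OF d k] tower_term_le[OF d' C_pos]]
      show ?thesis by simp
    qed
    have "(\<integral>x. cmod (f x - d' 1) \<partial>\<mu>) = (\<Sum>k\<in>{1..C n}. h n k * (LINT x:B n k|\<mu>. cmod (f x - d' 1)))"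
    proof (rule integral_towers_invariant)
      show "AE x in \<mu>. cmod (f (T x) - d' 1) = cmod (f x - d' 1)"
        using inv by eventually_elim simp
    qed (use f in auto)
    also have "\<dots> \<le> (\<Sum>k\<in>{1..C n}. h n k * (LINT x:B n k|\<mu>. cmod (f x - d k)) +
        (L\<^sup>2 + L) * \<epsilon> * (h n k * prob (B n k)))"
    proof (rule sum_mono)
      fix k assume k: "k \<in> {1..C n}"
      note Bk = B_sets[OF k]
      have "(LINT x:B n k|\<mu>. cmod (f x - d' 1)) \<le> (LINT x:B n k|\<mu>. cmod (f x - d k) + (L\<^sup>2 + L) * \<epsilon>)"
      proof (rule set_integral_mono)
        fix x
        have "cmod (f x - d' 1) \<le> cmod (f x - d k) + cmod (d k - d' 1)"
          by (rule order_trans[OF _ norm_triangle_ineq]) simp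
        then show "cmod (f x - d' 1) \<le> cmod (f x - d k) + (L\<^sup>2 + L) * \<epsilon>" using close[OF k] by simp
      qed (use f Bk in \<open>auto intro!: set_integrable_of_integrable\<close>)
      also have "\<dots> = (LINT x:B n k|\<mu>. cmod (f x - d k)) + (LINT x:B n k|\<mu>. (L\<^sup>2 + L) * \<epsilon>)"
        using f Bk by (intro set_integral_add set_integrable_of_integrable) auto
      also have "(LINT x:B n k|\<mu>. (L\<^sup>2 + L) * \<epsilon>) = (L\<^sup>2 + L) * \<epsilon> * prob (B n k)"
        using Bk by (simp add: set_lebesgue_integral_def)
      finally have "h n k * (LINT x:B n k|\<mu>. cmod (f x - d' 1)) \<le>
          h n k * ((LINT x:B n k|\<mu>. cmod (f x - d k)) + (L\<^sup>2 + L) * \<epsilon> * prob (B n k))"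
        by (intro mult_left_mono) auto
      also have "\<dots> = h n k * (LINT x:B n k|\<mu>. cmod (f x - d k)) + (L\<^sup>2 + L) * \<epsilon> * (h n k * prob (B n k))"
        by (simp add: algebra_simps)
      finally show "h n k * (LINT x:B n k|\<mu>. cmod (f x - d' 1)) \<le>
          h n k * (LINT x:B n k|\<mu>. cmod (f x - d k)) + (L\<^sup>2 + L) * \<epsilon> * (h n k * prob (B n k))" .
    qed
    also have "\<dots> = (\<Sum>k\<in>{1..C n}. h n k * (LINT x:B n k|\<mu>. cmod (f x - d k))) + (L\<^sup>2 + L) * \<epsilon>"
      by (simp only: sum.distrib sum_distrib_left[symmetric] tower_mass mult_1_right)
    also have "\<dots> \<le> K * \<epsilon>" using d by (simp add: K_def algebra_simps)
    finally have c: "(\<integral>x. cmod (f x - d' 1) \<partial>\<mu>) \<le> K * \<epsilon>" .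
    \<comment> \<open>The constant \<open>d' 1\<close> depends on \<open>\<epsilon>\<close>;
      replacing it by the fixed value \<open>I\<close> costs another
      \<open>K * \<epsilon>\<close>.\<close>
    have "I - d' 1 = (\<integral>x. f x - d' 1 \<partial>\<mu>)" using f by (simp add: I_def prob_space)
    then have "cmod (I - d' 1) \<le> (\<integral>x. cmod (f x - d' 1) \<partial>\<mu>)"
      by (metis integral_norm_bound)
    then have cI: "cmod (I - d' 1) \<le> K * \<epsilon>" using c by simp
    have "(\<integral>x. cmod (f x - I) \<partial>\<mu>) \<le> (\<integral>x. cmod (f x - d' 1) + K * \<epsilon> \<partial>\<mu>)"
    proof (rule integral_mono)
      fix x
      have "cmod (f x - I) \<le> cmod (f x - d' 1) + cmod (d' 1 - I)"
        by (rule order_trans[OF _ norm_triangle_ineq]) simp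
      then show "cmod (f x - I) \<le> cmod (f x - d' 1) + K * \<epsilon>"
        using cI by (simp add: norm_minus_commute)
    qed (use f in auto)
    also have "\<dots> = (\<integral>x. cmod (f x - d' 1) \<partial>\<mu>) + K * \<epsilon>" using f by (simp add: prob_space)
    finally show ?thesis using c by simp
  qed
  have "(\<integral>x. cmod (f x - I) \<partial>\<mu>) \<le> 0"
  proof (rule field_le_epsilon)
    fix e :: real assume "0 < e"
    then show "(\<integral>x. cmod (f x - I) \<partial>\<mu>) \<le> 0 + e" using near[of "e / (2 * K)"] K by simp
  qed
  moreover have "0 \<le> (\<integral>x. cmod (f x - I) \<partial>\<mu>)" by (rule integral_nonneg_AE) simp
  ultimately have "(\<integral>x. cmod (f x - I) \<partial>\<mu>) = 0" by simp
  moreover have "integrable \<mu> (\<lambda>x. cmod (f x - I))" using f by simp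
  ultimately have "AE x in \<mu>. cmod (f x - I) = 0"
    by (subst (asm) integral_nonneg_eq_0_iff_AE) auto
  then show ?thesis unfolding I_def by eventually_elim simp
qed

lemma eigenvalue_norm:
  assumes f: "integrable \<mu> f" and nz: "\<not> (AE x in \<mu>. f x = 0)"
    and eig: "AE x in \<mu>. f (T x) = \<zeta> * f x"
  shows "cmod \<zeta> = 1"
proof -
  note [measurable] = borel_measurable_integrable[OF f]
  have "(\<integral>x. cmod (f x) \<partial>\<mu>) = (\<integral>x. cmod (f (T x)) \<partial>\<mu>)"
    using integral_funpow[of "\<lambda>x. cmod (f x)" 1] by simp
  also have "\<dots> = (\<integral>x. cmod \<zeta> * cmod (f x) \<partial>\<mu>)"
  proof (rule integral_cong_AE)
    show "AE x in \<mu>. cmod (f (T x)) = cmod \<zeta> * cmod (f x)"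
      using eig by eventually_elim (simp add: norm_mult)
  qed measurable
  finally have "(\<integral>x. cmod (f x) \<partial>\<mu>) = cmod \<zeta> * (\<integral>x. cmod (f x) \<partial>\<mu>)" by simp
  moreover have "(\<integral>x. cmod (f x) \<partial>\<mu>) \<noteq> 0"
    using nz f by (subst integral_nonneg_eq_0_iff_AE) auto
  ultimately show ?thesis by simp
qed

lemma eigenfunction_norm_constant:
  assumes f: "integrable \<mu> f" and nz: "\<not> (AE x in \<mu>. f x = 0)"
    and eig: "AE x in \<mu>. f (T x) = \<zeta> * f x"
  obtains r where "0 < r" "AE x in \<mu>. cmod (f x) = r"
proof -
  have "integrable \<mu> (\<lambda>x. complex_of_real (cmod (f x)))" using f by simp
  moreover have "AE x in \<mu>. complex_of_real (cmod (f (T x))) = complex_of_real (cmod (f x))"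
    using eig by eventually_elim (simp add: norm_mult eigenvalue_norm[OF f nz eig])
  ultimately have "AE x in \<mu>. complex_of_real (cmod (f x)) = (\<integral>x. complex_of_real (cmod (f x)) \<partial>\<mu>)"
    by (rule invariant_function_constant)
  then have r: "AE x in \<mu>. cmod (f x) = (\<integral>x. cmod (f x) \<partial>\<mu>)" using f by simp
  have "(\<integral>x. cmod (f x) \<partial>\<mu>) \<noteq> 0"
    using nz f by (subst integral_nonneg_eq_0_iff_AE) auto
  moreover have "0 \<le> (\<integral>x. cmod (f x) \<partial>\<mu>)" by (rule integral_nonneg_AE) simp
  ultimately have "0 < (\<integral>x. cmod (f x) \<partial>\<mu>)" by linarith
  then show ?thesis by (rule that[OF _ r])
qed

text \<open>Comparing \<open>d 1\<close> with the same \<open>d' l\<close> at the indices 0 and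
  \<open>h (Suc n) l\<close> cancels \<open>d' l\<close> and leaves
  \<open>(\<zeta> ^ h (Suc n) l - 1) * d 1\<close>. The second factor can be divided out because
  \<open>cmod (f x)\<close> is constant and nonzero.\<close>

lemma eigenvalue_power_heights:
  assumes f: "integrable \<mu> f" and nz: "\<not> (AE x in \<mu>. f x = 0)"
    and eig: "AE x in \<mu>. f (T x) = \<zeta> * f x" and e: "0 < (e::real)"
  obtains n0 where "\<And>n l. n \<ge> n0 \<Longrightarrow> l \<in> {1..C n} \<Longrightarrow> cmod (\<zeta> ^ h n l - 1) \<le> e"
proof -
  obtain L :: real where L: "0 < L"
    "\<And>n l k. l \<in> {1..C (Suc n)} \<Longrightarrow> k \<in> {1..C n} \<Longrightarrow> h (Suc n) l \<le> L * h n k"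
    using linear_growth by blast
  have \<zeta>: "cmod \<zeta> = 1" by (rule eigenvalue_norm[OF f nz eig])
  obtain r where r: "0 < r" "AE x in \<mu>. cmod (f x) = r"
    using eigenfunction_norm_constant[OF f nz eig] .
  \<comment> \<open>The first entry of the minimum yields \<open>cmod (d 1) \<ge> r / 2\<close>; the
    second makes the two comparison errors add up to at most \<open>e * r / 2\<close>.\<close>
  define \<epsilon> where "\<epsilon> = min (r / (2 * L)) (e * r / (4 * (L\<^sup>2 + L)))"
  have LL: "0 < L\<^sup>2 + L" using L(1) by (simp add: add_pos_pos)
  have \<epsilon>: "0 < \<epsilon>" "L * \<epsilon> \<le> r / 2" "(L\<^sup>2 + L) * \<epsilon> \<le> e * r / 4"
  proof -
    show "0 < \<epsilon>" using r(1) L(1) LL e by (simp add: \<epsilon>_def)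
    have "L * \<epsilon> \<le> L * (r / (2 * L))" using L(1) by (intro mult_left_mono) (auto simp: \<epsilon>_def)
    then show "L * \<epsilon> \<le> r / 2" using L(1) by simp
    have "(L\<^sup>2 + L) * \<epsilon> \<le> (L\<^sup>2 + L) * (e * r / (4 * (L\<^sup>2 + L)))"
      using LL by (intro mult_left_mono) (auto simp: \<epsilon>_def)
    also have "c * (e * r / (4 * c)) = e * r / 4" if "0 < c" for c using that by simp
    note this[OF LL]
    finally show "(L\<^sup>2 + L) * \<epsilon> \<le> e * r / 4" .
  qed
  obtain n0 where n0: "\<And>m. m \<ge> n0 \<Longrightarrow> \<exists>d. (\<Sum>k\<in>{1..C m}. h m k * (LINT x:B m k|\<mu>. cmod (f x - d k))) \<le> \<epsilon>"
    using tower_constants[OF f eig \<zeta> \<epsilon>(1)] by blast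
  have "cmod (\<zeta> ^ h (Suc n) l - 1) \<le> e" if n: "n \<ge> n0" and l: "l \<in> {1..C (Suc n)}" for n l
  proof -
    obtain d where d: "(\<Sum>k\<in>{1..C n}. h n k * (LINT x:B n k|\<mu>. cmod (f x - d k))) \<le> \<epsilon>"
      using n0[of n] n by auto
    obtain d' where d': "(\<Sum>k\<in>{1..C (Suc n)}. h (Suc n) k * (LINT x:B (Suc n) k|\<mu>. cmod (f x - d' k))) \<le> \<epsilon>"
      using n0[of "Suc n"] n by auto
    have close: "cmod (\<zeta> ^ j * d 1 - d' l) \<le> e * r / 4" if "lev (Suc n) l j \<subseteq> B n 1" for j
      using tower_constants_close[OF f eig \<zeta> L C_pos l that tower_term_le[OF d C_pos] tower_term_le[OF d' l]] \<epsilon>(3)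
      by linarith
    have "lev (Suc n) l 0 \<subseteq> B n 1" using level_0[OF l] base_subset[OF l] by simp
    note c0 = close[OF this]
    have "lev (Suc n) l (h (Suc n) l) \<subseteq> B n 1"
    proof
      fix x assume "x \<in> lev (Suc n) l (h (Suc n) l)"
      then obtain k where "k \<in> {1..C (Suc n)}" "x \<in> B (Suc n) k" using return_to_base[OF l] by blast
      then show "x \<in> B n 1" using base_subset by blast
    qed
    note c1 = close[OF this]
    have "(\<zeta> ^ h (Suc n) l - 1) * d 1 = (\<zeta> ^ h (Suc n) l * d 1 - d' l) - (\<zeta> ^ 0 * d 1 - d' l)"
      by (simp add: algebra_simps)
    then have "cmod ((\<zeta> ^ h (Suc n) l - 1) * d 1) \<le> e * r / 4 + e * r / 4"
      using norm_triangle_ineq4 c0 c1 by (smt (verit))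
    then have up: "cmod (\<zeta> ^ h (Suc n) l - 1) * cmod (d 1) \<le> e * (r / 2)" by (simp add: norm_mult)
    have "r / 2 \<le> cmod (d 1)"
    proof -
      note B1 = B_sets[OF C_pos, of n]
      let ?m = "prob (B n 1)"
      have m: "1 \<le> L * h n 1 * ?m"
        by (rule tower_mass_ge[OF L(2)[OF _ C_pos] C_pos])
      then have "0 < L * (h n 1 * ?m)" by (simp only: mult.assoc)
      then have h_m: "0 < h n 1 * ?m" by (rule zero_less_mult_pos[OF _ L(1)])
      \<comment> \<open>The reverse triangle inequality is integrated over the base. As the tower
        has mass at least \<open>1 / L\<close>, it follows that \<open>r - cmod (d 1)\<close> is at
        most \<open>L * \<epsilon>\<close>.\<close>
      have "?m * (r - cmod (d 1)) = (LINT x:B n 1|\<mu>. r - cmod (d 1))"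
        using B1 by (simp add: set_lebesgue_integral_def)
      also have "\<dots> \<le> (LINT x:B n 1|\<mu>. cmod (f x - d 1))"
      proof (rule set_integral_mono_AE)
        show "AE x\<in>B n 1 in \<mu>. r - cmod (d 1) \<le> cmod (f x - d 1)"
          using r(2) by eventually_elim (metis norm_triangle_ineq2)
      qed (use f B1 in \<open>auto intro!: set_integrable_of_integrable\<close>)
      finally have "h n 1 * (?m * (r - cmod (d 1))) \<le> h n 1 * (LINT x:B n 1|\<mu>. cmod (f x - d 1))"
        by (intro mult_left_mono) auto
      also have "\<dots> \<le> \<epsilon>" by (rule tower_term_le[OF d C_pos])
      also have "\<epsilon> \<le> (L * h n 1 * ?m) * \<epsilon>" using m \<epsilon>(1) by simp
      also have "\<dots> = (h n 1 * ?m) * (L * \<epsilon>)" by simp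
      also have "\<dots> \<le> (h n 1 * ?m) * (r / 2)" using \<epsilon>(2) h_m by (intro mult_left_mono) auto
      finally have "(h n 1 * ?m) * (r - cmod (d 1)) \<le> (h n 1 * ?m) * (r / 2)" by (simp only: mult.assoc)
      then have "r - cmod (d 1) \<le> r / 2" using mult_le_cancel_left_pos[OF h_m] by blast
      then show ?thesis by linarith
    qed
    then have "cmod (\<zeta> ^ h (Suc n) l - 1) * (r / 2) \<le> e * (r / 2)"
      using up mult_left_mono[OF _ norm_ge_zero] order_trans by blast
    then show ?thesis using r(1) by simp
  qed
  then have "cmod (\<zeta> ^ h n l - 1) \<le> e" if "n \<ge> Suc n0" "l \<in> {1..C n}" for n l
    using that by (cases n) auto
  then show ?thesis using that by blast
qed

section \<open>From decay of the phases to continuity\<close>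

lemma eigenfunction_integrable:
  assumes "eigenfunction T \<mu> \<zeta> f" shows "integrable \<mu> f"
proof -
  have f: "f \<in> borel_measurable \<mu>" and i: "integrable \<mu> (\<lambda>x. (cmod (f x))\<^sup>2)"
    using assms by (auto simp: eigenfunction_def)
  have "integrable \<mu> (\<lambda>x. 1 + (cmod (f x))\<^sup>2)" using i by simp
  then show ?thesis
  proof (rule Bochner_Integration.integrable_bound[OF _ f])
    have "t \<le> 1 + t\<^sup>2" for t :: real using sum_squares_bound[of t "1/2"] by (simp add: power_divide)
    then show "AE x in \<mu>. norm (f x) \<le> norm (1 + (cmod (f x))\<^sup>2)" by simp
  qed
qed

text \<open>As \<open>cmod (g x) = 1\<close>, the conjugate of \<open>g\<close> is its inverse:
  \<open>f\<close> times this conjugate is a quotient of two eigenfunctions with the same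
  eigenvalue, hence invariant.\<close>

lemma ae_continuous_of_summable:
  assumes eig: "eigenfunction T \<mu> \<zeta> f"
    and \<delta>: "\<And>n k. k \<in> {1..C n} \<Longrightarrow> cmod (\<zeta> ^ h n k - 1) \<le> \<delta> n" "summable \<delta>"
  shows "ae_continuous_eigenfunction X T \<mu> \<zeta> f"
proof -
  have f: "integrable \<mu> f" and nz: "\<not> (AE x in \<mu>. f x = 0)"
    and eq: "AE x in \<mu>. f (T x) = \<zeta> * f x"
    using eig eigenfunction_integrable unfolding eigenfunction_def by blast+
  have \<zeta>: "cmod \<zeta> = 1" by (rule eigenvalue_norm[OF f nz eq])
  obtain g where g: "continuous_map X euclidean g"
    "\<And>x. x \<in> topspace X \<Longrightarrow> cmod (g x) = 1"
    "\<And>x. x \<in> topspace X \<Longrightarrow> g (T x) = \<zeta> * g x"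
    using continuous_eigenfunction_of_summable[OF \<zeta> \<delta>] by blast
  have g_meas [measurable]: "g \<in> borel_measurable \<mu>"
  proof (rule borel_measurableI)
    fix U :: "complex set" assume "open U"
    then have "openin X {x \<in> topspace X. g x \<in> U}" using g(1) by (simp add: continuous_map_def)
    then show "g -` U \<inter> space \<mu> \<in> sets \<mu>"
      using openin_sets by (simp add: space_\<mu> vimage_def Int_def conj_commute)
  qed
  note [measurable] = borel_measurable_integrable[OF f]
  have [measurable]: "cnj \<in> borel_measurable borel"
    by (intro borel_measurable_continuous_onI continuous_intros)
  have "integrable \<mu> (\<lambda>x. f x * cnj (g x))"
    by (rule Bochner_Integration.integrable_bound[OF f]) (auto simp: norm_mult g(2) space_\<mu>)
  moreover have "AE x in \<mu>. f (T x) * cnj (g (T x)) = f x * cnj (g x)"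
    using eq AE_space
  proof eventually_elim
    case (elim x)
    have "\<zeta> * cnj \<zeta> = 1" using \<zeta> by (simp add: complex_norm_square[symmetric])
    then show ?case using elim g(3) by (simp add: space_\<mu> mult_ac)
  qed
  ultimately obtain \<kappa> where \<kappa>: "AE x in \<mu>. f x * cnj (g x) = \<kappa>"
    using invariant_function_constant by blast
  have "AE x in \<mu>. f x = \<kappa> * g x"
    using \<kappa> AE_space
  proof eventually_elim
    case (elim x)
    have "cnj (g x) * g x = 1" using elim g(2) by (simp add: space_\<mu> complex_norm_square[symmetric] mult.commute)
    then show ?case using elim(1) by (metis mult.assoc mult.right_neutral)
  qed
  moreover have "continuous_map X euclidean (\<lambda>x. \<kappa> * g x)"
    using continuous_map_compose[OF g(1), of euclidean "\<lambda>z. \<kappa> * z"]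
    by (simp add: o_def continuous_intros)
  ultimately show ?thesis
    unfolding ae_continuous_eigenfunction_def using g(3) by (intro exI[of _ "\<lambda>x. \<kappa> * g x"]) auto
qed

text \<open>Continuity of \<open>Ln\<close> at 1 transfers the uniform convergence of the powers to
  their arguments.\<close>

lemma phase_tendsto_0:
  assumes eig: "eigenfunction T \<mu> \<zeta> f" and e: "0 < e"
  shows "\<exists>n0. \<forall>n\<ge>n0. \<forall>l\<in>{1..C n}. \<bar>phase \<zeta> n l\<bar> \<le> e"
proof -
  have f: "integrable \<mu> f" and nz: "\<not> (AE x in \<mu>. f x = 0)"
    and eq: "AE x in \<mu>. f (T x) = \<zeta> * f x"
    using eig eigenfunction_integrable unfolding eigenfunction_def by blast+
  have "isCont Ln 1" by (rule continuous_at_Ln) auto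
  then have "(Ln \<longlongrightarrow> 0) (at 1)" by (simp add: isCont_def)
  then obtain d where d: "0 < d" "\<And>z. z \<noteq> 1 \<Longrightarrow> dist z 1 < d \<Longrightarrow> dist (Ln z) 0 < e"
    using e by (auto simp: tendsto_iff eventually_at)
  have Ln_small: "\<bar>Im (Ln z)\<bar> \<le> e" if "cmod (z - 1) < d" for z
  proof (cases "z = 1")
    case False
    then have "cmod (Ln z) < e" using d(2)[of z] that by (simp add: dist_norm)
    then show ?thesis using abs_Im_le_cmod[of "Ln z"] by simp
  qed (use e in simp)
  have "0 < d / 2" using d by simp
  then obtain n0 where "\<And>n l. n \<ge> n0 \<Longrightarrow> l \<in> {1..C n} \<Longrightarrow> cmod (\<zeta> ^ h n l - 1) \<le> d / 2"
    using eigenvalue_power_heights[OF f nz eq] by blast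
  then have "\<bar>phase \<zeta> n l\<bar> \<le> e" if "n \<ge> n0" "l \<in> {1..C n}" for n l
    unfolding phase_def using that d(1) by (intro Ln_small) (smt (verit) field_sum_of_halves)
  then show ?thesis by blast
qed

lemma phase_eventually_linear:
  assumes eig: "eigenfunction T \<mu> \<zeta> f"
  obtains n0 where "\<And>n l. n \<ge> n0 \<Longrightarrow> l \<in> {1..C (Suc n)} \<Longrightarrow>
    phase \<zeta> (Suc n) l = (\<Sum>k\<in>{1..C n}. card (visits n l k) * phase \<zeta> n k)"
proof -
  obtain L :: real where L: "0 < L"
    "\<And>n l k. l \<in> {1..C (Suc n)} \<Longrightarrow> k \<in> {1..C n} \<Longrightarrow> h (Suc n) l \<le> L * h n k"
    using linear_growth by blast
  have \<zeta>: "cmod \<zeta> = 1"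
    using eigenvalue_norm[of f \<zeta>] eig eigenfunction_integrable[OF eig] unfolding eigenfunction_def by blast
  \<comment> \<open>With row sums at most \<open>L\<close>, the bound \<open>1 / L\<close> keeps
    every combination of phases within 1 of 0, inside the principal branch.\<close>
  have "0 < 1 / L" using L by simp
  then obtain n0 where n0: "\<And>n k. n \<ge> n0 \<Longrightarrow> k \<in> {1..C n} \<Longrightarrow> \<bar>phase \<zeta> n k\<bar> \<le> 1 / L"
    using phase_tendsto_0[OF eig] by blast
  have "phase \<zeta> (Suc n) l = (\<Sum>k\<in>{1..C n}. card (visits n l k) * phase \<zeta> n k)"
    if n: "n \<ge> n0" and l: "l \<in> {1..C (Suc n)}" for n l
  proof (rule phase_Suc[OF \<zeta> l])
    have "\<bar>\<Sum>k\<in>{1..C n}. card (visits n l k) * phase \<zeta> n k\<bar> \<le>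
        (\<Sum>k\<in>{1..C n}. \<bar>card (visits n l k) * phase \<zeta> n k\<bar>)" by (rule sum_abs)
    also have "\<dots> \<le> (\<Sum>k\<in>{1..C n}. card (visits n l k) * (1 / L))"
      using n0[OF n] by (intro sum_mono) (simp only: abs_mult abs_of_nat mult_left_mono of_nat_0_le_iff)
    also have "\<dots> = (\<Sum>k\<in>{1..C n}. real (card (visits n l k))) * (1 / L)"
      by (simp only: sum_distrib_right)
    also have "\<dots> \<le> L * (1 / L)"
      using sum_card_visits_le[OF l L(2)[OF l]] L(1) by (intro mult_right_mono) auto
    also have "\<dots> < pi" using L(1) pi_gt3 by simp
    finally show "\<bar>\<Sum>k\<in>{1..C n}. card (visits n l k) * phase \<zeta> n k\<bar> < pi" .
  qed
  then show ?thesis using that by blast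
qed

lemma ae_continuous_of_exponential_decay:
  assumes eig: "eigenfunction T \<mu> \<zeta> f" and c: "0 < c"
    and decay: "\<And>n l. n \<ge> n1 \<Longrightarrow> l \<in> {1..C n} \<Longrightarrow> \<bar>phase \<zeta> n l\<bar> \<le> K * exp (- (c * real n))"
  shows "ae_continuous_eigenfunction X T \<mu> \<zeta> f"
proof -
  have \<zeta>: "cmod \<zeta> = 1"
    using eigenvalue_norm[of f \<zeta>] eig eigenfunction_integrable[OF eig] unfolding eigenfunction_def by blast
  \<comment> \<open>Before \<open>n1\<close> no bound on the phases is available, but two points of
    the unit circle are at most 2 apart.\<close>
  define \<delta> where "\<delta> n = (if n < n1 then 2 else K * exp (- c) ^ n)" for n
  have "cmod (\<zeta> ^ h n k - 1) \<le> \<delta> n" if k: "k \<in> {1..C n}" for n k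
  proof (cases "n < n1")
    case True
    have "cmod (\<zeta> ^ h n k - 1) \<le> cmod (\<zeta> ^ h n k) + cmod 1" by (rule norm_triangle_ineq4)
    then show ?thesis using True \<zeta> by (simp add: \<delta>_def norm_power)
  next
    case False
    have "cmod (\<zeta> ^ h n k - 1) \<le> \<bar>phase \<zeta> n k\<bar>" by (rule norm_power_height_le[OF \<zeta>])
    also have "\<dots> \<le> K * exp (- (c * real n))" using decay k False by simp
    also have "exp (- (c * real n)) = exp (- c) ^ n"
      by (simp add: exp_of_nat_mult[symmetric] mult.commute)
    finally show ?thesis using False by (simp add: \<delta>_def)
  qed
  moreover have "summable \<delta>"
  proof (rule summable_comparison_test_ev)
    show "summable (\<lambda>n. \<bar>K\<bar> * exp (- c) ^ n)" using c by (intro summable_mult summable_geometric) simp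
    show "\<forall>\<^sub>F n in sequentially. norm (\<delta> n) \<le> \<bar>K\<bar> * exp (- c) ^ n"
      using eventually_ge_at_top[of n1] by eventually_elim (simp add: \<delta>_def abs_mult)
  qed
  ultimately show ?thesis by (rule ae_continuous_of_summable[OF eig])
qed

end

section \<open>The matrix cocycle\<close>

lemma norm_on_triangle:
  assumes "norm_on k N" "v \<in> carrier_vec k" "w \<in> carrier_vec k"
  shows "N (v + w) \<le> N v + N w"
  using assms by (simp add: norm_on_def)

lemma norm_on_vec_le:
  assumes N: "norm_on k N"
  shows "N (Matrix.vec k f) \<le> (\<Sum>i<k. \<bar>f i\<bar> * N (unit_vec k i))"
proof -
  have "N (Matrix.vec k (\<lambda>i. if i < m then f i else 0)) \<le> (\<Sum>i<m. \<bar>f i\<bar> * N (unit_vec k i))"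
    if "m \<le> k" for m
    using that
  proof (induction m)
    case 0
    have "Matrix.vec k (\<lambda>i. 0) = (0\<^sub>v k :: real Matrix.vec)" by (rule eq_vecI) auto
    moreover have "N (0\<^sub>v k) = 0" using N unfolding norm_on_def by (metis zero_carrier_vec)
    ultimately show ?case by simp
  next
    case (Suc m)
    have "Matrix.vec k (\<lambda>i. if i < Suc m then f i else 0) =
        Matrix.vec k (\<lambda>i. if i < m then f i else 0) + f m \<cdot>\<^sub>v unit_vec k m"
      using Suc.prems by (intro eq_vecI) (auto simp: less_Suc_eq)
    moreover have "N (Matrix.vec k (\<lambda>i. if i < m then f i else 0) + f m \<cdot>\<^sub>v unit_vec k m)
        \<le> N (Matrix.vec k (\<lambda>i. if i < m then f i else 0)) + N (f m \<cdot>\<^sub>v unit_vec k m)"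
      by (rule norm_on_triangle[OF N]) auto
    moreover have "N (f m \<cdot>\<^sub>v unit_vec k m) = \<bar>f m\<bar> * N (unit_vec k m)"
      using N by (simp add: norm_on_def)
    ultimately show ?case using Suc by simp
  qed
  moreover have "Matrix.vec k (\<lambda>i. if i < k then f i else 0) = Matrix.vec k f"
    by (rule eq_vecI) auto
  ultimately show ?thesis by (metis order_refl)
qed

text \<open>This supplies the continuity of the norm in the coordinates for the compactness argument
  below.\<close>

lemma norm_on_vec_diff:
  assumes N: "norm_on k N"
  shows "\<bar>N (Matrix.vec k f) - N (Matrix.vec k g)\<bar> \<le> (\<Sum>i<k. \<bar>f i - g i\<bar> * N (unit_vec k i))"
proof -
  have *: "N (Matrix.vec k f) - N (Matrix.vec k g) \<le> (\<Sum>i<k. \<bar>f i - g i\<bar> * N (unit_vec k i))" for f g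
  proof -
    have "Matrix.vec k f = Matrix.vec k g + Matrix.vec k (\<lambda>i. f i - g i)" by (rule eq_vecI) auto
    moreover have "N (Matrix.vec k g + Matrix.vec k (\<lambda>i. f i - g i)) \<le>
        N (Matrix.vec k g) + N (Matrix.vec k (\<lambda>i. f i - g i))"
      using N by (simp add: norm_on_def)
    ultimately show ?thesis using norm_on_vec_le[OF N, of "\<lambda>i. f i - g i"] by simp
  qed
  show ?thesis using *[of f g] *[of g f] by (simp add: abs_minus_commute)
qed

text \<open>By compactness the norm has a positive minimum on the unit sphere of the maximum norm;
  homogeneity extends the bound to all vectors.\<close>

lemma norm_on_lower_bound:
  assumes N: "norm_on k N"
  obtains c where "0 < c" "\<And>f i. i < k \<Longrightarrow> c * \<bar>f i\<bar> \<le> N (Matrix.vec k f)"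
proof (cases "k = 0")
  case True
  then show ?thesis using that[of 1] by simp
next
  case False
  \<comment> \<open>Vectors are coded as functions on the naturals that vanish from \<open>k\<close>
    on. This makes the cube \<open>Q\<close> a product of compact sets, and \<open>S\<close> is the
    unit sphere of the maximum norm.\<close>
  define Q :: "(nat \<Rightarrow> real) set" where "Q = PiE UNIV (\<lambda>i. if i < k then {-1..1} else {0})"
  define S where "S = Q \<inter> (\<Union>i<k. {f. \<bar>f i\<bar> = 1})"
  have "compactin (product_topology (\<lambda>_. euclidean) UNIV) Q"
    unfolding Q_def by (subst compactin_PiE) auto
  then have "compact Q"
    by (simp add: euclidean_product_topology)
  moreover have "closed (\<Union>i<k. {f :: nat \<Rightarrow> real. \<bar>f i\<bar> = 1})"
    by (intro closed_UN ballI closed_Collect_eq continuous_intros continuous_on_product_coordinates) auto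
  ultimately have S: "compact S" unfolding S_def by (rule compact_Int_closed)
  have "continuous_on S (\<lambda>f. N (Matrix.vec k f))"
    unfolding continuous_on_def
  proof
    fix g assume "g \<in> S"
    then have "((\<lambda>f. f i) \<longlongrightarrow> g i) (at g within S)" for i
      using continuous_on_subset[OF continuous_on_product_coordinates[of i] subset_UNIV, of S]
      unfolding continuous_on_def by blast
    then have "((\<lambda>f. \<Sum>i<k. \<bar>f i - g i\<bar> * N (unit_vec k i)) \<longlongrightarrow> (\<Sum>i<k. \<bar>g i - g i\<bar> * N (unit_vec k i)))
        (at g within S)"
      by (intro tendsto_intros)
    then have sum0: "((\<lambda>f. \<Sum>i<k. \<bar>f i - g i\<bar> * N (unit_vec k i)) \<longlongrightarrow> 0) (at g within S)" by simp
    have "((\<lambda>f. N (Matrix.vec k f) - N (Matrix.vec k g)) \<longlongrightarrow> 0) (at g within S)"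
      by (rule Lim_null_comparison[OF always_eventually sum0]) (simp add: norm_on_vec_diff[OF N])
    then show "((\<lambda>f. N (Matrix.vec k f)) \<longlongrightarrow> N (Matrix.vec k g)) (at g within S)"
      by (simp add: LIM_zero_iff)
  qed
  moreover have "(\<lambda>i. if i < k then 1 else 0) \<in> S"
    using False by (auto simp: S_def Q_def)
  ultimately obtain g where g: "g \<in> S" "\<And>f. f \<in> S \<Longrightarrow> N (Matrix.vec k g) \<le> N (Matrix.vec k f)"
    using continuous_attains_inf[OF S] by blast
  show ?thesis
  proof
    have "Matrix.vec k g \<noteq> 0\<^sub>v k"
    proof
      assume "Matrix.vec k g = 0\<^sub>v k"
      then have "g i = 0" if "i < k" for i using that by (metis index_vec index_zero_vec(1))
      then show False using g(1) by (auto simp: S_def)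
    qed
    moreover have "0 \<le> N (Matrix.vec k g)" "N (Matrix.vec k g) = 0 \<longleftrightarrow> Matrix.vec k g = 0\<^sub>v k"
      using N by (auto simp: norm_on_def)
    ultimately show "0 < N (Matrix.vec k g)" by linarith
    fix f :: "nat \<Rightarrow> real" and i assume i: "i < k"
    \<comment> \<open>Dividing by the maximum norm \<open>m\<close>, when it is nonzero, moves
      \<open>f\<close> to the sphere.\<close>
    define m where "m = Max ((\<lambda>i. \<bar>f i\<bar>) ` {..<k})"
    have "m \<in> (\<lambda>i. \<bar>f i\<bar>) ` {..<k}" unfolding m_def using False by (intro Max_in) auto
    then obtain i0 where i0: "i0 < k" "m = \<bar>f i0\<bar>" by auto
    have le_m: "\<bar>f i\<bar> \<le> m" if "i < k" for i using that by (auto simp: m_def)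
    show "N (Matrix.vec k g) * \<bar>f i\<bar> \<le> N (Matrix.vec k f)"
    proof (cases "m = 0")
      case True
      have "0 \<le> N (Matrix.vec k f)" using N by (simp add: norm_on_def)
      then show ?thesis using le_m[OF i] True by simp
    next
      case False
      then have m: "0 < m" using i0 by simp
      define f' where "f' = (\<lambda>i. if i < k then f i / m else 0)"
      have "f' i \<in> {-1..1}" if "i < k" for i
      proof -
        have "\<bar>f i\<bar> / m \<le> 1" using le_m[OF that] m by simp
        then have "\<bar>f' i\<bar> \<le> 1" using that m by (simp add: f'_def)
        then show ?thesis by (simp add: abs_le_iff)
      qed
      moreover have "\<bar>f' i0\<bar> = 1" using i0 m by (simp add: f'_def)
      ultimately have "f' \<in> S" using i0(1) by (auto simp: S_def Q_def f'_def)
      then have "N (Matrix.vec k g) \<le> N (Matrix.vec k f')" by (rule g(2))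
      then have "N (Matrix.vec k g) * m \<le> m * N (Matrix.vec k f')" using m by (simp add: mult.commute)
      also have "\<dots> = N (m \<cdot>\<^sub>v Matrix.vec k f')" using N m by (simp add: norm_on_def)
      also have "m \<cdot>\<^sub>v Matrix.vec k f' = Matrix.vec k f" using m by (intro eq_vecI) (auto simp: f'_def)
      finally have "N (Matrix.vec k g) * m \<le> N (Matrix.vec k f)" .
      moreover have "N (Matrix.vec k g) * \<bar>f i\<bar> \<le> N (Matrix.vec k g) * m"
        using le_m[OF i] \<open>0 < N (Matrix.vec k g)\<close> by simp
      ultimately show ?thesis by linarith
    qed
  qed
qed

text \<open>The norm is arbitrary, so it is compared with the coordinates in both directions: from
  above to see that the exponent is not positive, from below to bring the exponential bound back to
  the coordinates.\<close>

lemma exponential_decay_of_nonzero_exponent: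
  fixes u :: "nat \<Rightarrow> nat \<Rightarrow> real"
  assumes N: "norm_on k N"
    and u: "\<And>i. i < k \<Longrightarrow> (\<lambda>p. u p i) \<longlonglongrightarrow> 0"
    and lim: "(\<lambda>p. ereal (1 / real p) * log_ext (N (Matrix.vec k (u p)))) \<longlonglongrightarrow> l" and "l \<noteq> 0"
  obtains c K p0 where "0 < c" "\<And>p i. p \<ge> p0 \<Longrightarrow> i < k \<Longrightarrow> \<bar>u p i\<bar> \<le> K * exp (- (c * p))"
proof -
  have N0: "0 \<le> N (Matrix.vec k f)" for f using N by (simp add: norm_on_def)
  have "(\<lambda>p. \<Sum>i<k. \<bar>u p i\<bar> * N (unit_vec k i)) \<longlonglongrightarrow> (\<Sum>i<k. \<bar>0\<bar> * N (unit_vec k i))"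
    using u by (intro tendsto_intros) auto
  then have sum0: "(\<lambda>p. \<Sum>i<k. \<bar>u p i\<bar> * N (unit_vec k i)) \<longlonglongrightarrow> 0" by simp
  have "(\<lambda>p. N (Matrix.vec k (u p))) \<longlonglongrightarrow> 0"
    by (rule Lim_null_comparison[OF always_eventually sum0]) (simp add: norm_on_vec_le[OF N] N0)
  then have "\<forall>\<^sub>F p in sequentially. N (Matrix.vec k (u p)) < 1"
    by (rule order_tendstoD) simp
  then have "\<forall>\<^sub>F p in sequentially. ereal (1 / real p) * log_ext (N (Matrix.vec k (u p))) \<le> 0"
  proof eventually_elim
    case (elim p)
    then have "log_ext (N (Matrix.vec k (u p))) \<le> 0"
      using N0[of "u p"] by (auto simp: log_ext_def)
    then show ?case by (simp add: ereal_mult_le_0_iff)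
  qed
  then have "l \<le> 0" using tendsto_upperbound[OF lim] by simp
  then have "l < 0" using \<open>l \<noteq> 0\<close> by simp
  \<comment> \<open>As \<open>l\<close> may be \<open>-\<infinity>\<close>, a real number strictly
    between \<open>l\<close> and 0 provides the rate.\<close>
  then obtain x where x: "l < ereal x" "ereal x < 0" using ereal_dense2 by blast
  have "\<forall>\<^sub>F p in sequentially. ereal (1 / real p) * log_ext (N (Matrix.vec k (u p))) < ereal x"
    using lim x(1) by (rule order_tendstoD)
  then obtain p1 where p1: "\<And>p. p \<ge> p1 \<Longrightarrow> ereal (1 / real p) * log_ext (N (Matrix.vec k (u p))) < ereal x"
    by (auto simp: eventually_sequentially)
  \<comment> \<open>An index of at least 1 permits multiplication by \<open>p\<close>; a vanishing
    norm, whose logarithm is \<open>-\<infinity>\<close>, satisfies the bound trivially.\<close>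
  have bound: "N (Matrix.vec k (u p)) \<le> exp (x * p)" if p: "p \<ge> max 1 p1" for p
  proof (cases "N (Matrix.vec k (u p)) = 0")
    case False
    then have pos: "0 < N (Matrix.vec k (u p))" using N0[of "u p"] by simp
    have "ereal (1 / real p) * log_ext (N (Matrix.vec k (u p))) < ereal x" using p1 p by simp
    then have "ln (N (Matrix.vec k (u p))) / p < x" using False by (simp add: log_ext_def)
    then have "ln (N (Matrix.vec k (u p))) < x * p" using p by (simp add: divide_less_eq)
    then show ?thesis using pos by (metis exp_le_cancel_iff exp_ln less_imp_le)
  qed simp
  obtain c where c: "0 < c" "\<And>f i. i < k \<Longrightarrow> c * \<bar>f i\<bar> \<le> N (Matrix.vec k f)"
    using norm_on_lower_bound[OF N] by blast
  show ?thesis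
  proof
    show "0 < - x" using x(2) by simp
    fix p i assume "p \<ge> max 1 p1" "i < k"
    then have "c * \<bar>u p i\<bar> \<le> exp (x * p)" using bound[of p] c(2)[of i "u p"] by linarith
    then show "\<bar>u p i\<bar> \<le> (1 / c) * exp (- (- x * p))" using c(1) by (simp add: field_simps)
  qed
qed

section \<open>The phases as an orbit of the cocycle\<close>

lemma funpow_shift_apply: "1 \<le> m \<Longrightarrow> (shift ^^ p) M m = M (m + p)"
  by (induction p arbitrary: m) (simp_all add: shift_def)

lemma hyperbolic_decay:
  fixes u :: "nat \<Rightarrow> nat \<Rightarrow> real"
  assumes hyp: "hyperbolic_on MM \<nu> N B" and N: "norm_on (max_size MM) N" and M: "M \<in> B"
    and C: "\<And>n. n \<ge> 1 \<Longrightarrow> C n \<le> max_size MM"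
    and dims: "\<And>n. n \<ge> 1 \<Longrightarrow> dim_row (M (Suc n)) = C (Suc n)" "\<And>n. n \<ge> 1 \<Longrightarrow> dim_col (M (Suc n)) = C n"
    and n0: "n0 \<ge> 1"
    and rec: "\<And>n i. n \<ge> n0 \<Longrightarrow> i < C (Suc n) \<Longrightarrow> u (Suc n) i = (\<Sum>j<C n. M (Suc n) $$ (i, j) * u n j)"
    and lim: "\<And>\<epsilon>. 0 < \<epsilon> \<Longrightarrow> \<exists>n1. \<forall>n\<ge>n1. \<forall>i<C n. \<bar>u n i\<bar> \<le> \<epsilon>"
  obtains c K n1 where "0 < c" "\<And>n i. n \<ge> n1 \<Longrightarrow> i < C n \<Longrightarrow> \<bar>u n i\<bar> \<le> K * exp (- (c * n))"
proof -
  define k where "k = max_size MM"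
  have "shift ` B \<subseteq> B" using hyp by (simp add: hyperbolic_on_def)
  then have "(shift ^^ p) M \<in> B" for p by (induction p) (auto simp: M)
  then have MB: "(shift ^^ (n0 - 1)) M \<in> B" .
  \<comment> \<open>The lengths \<open>C n\<close> vary; extension by 0 matches the completion of
    the matrices by zero entries.\<close>
  define u' where "u' p i = (if i < C (n0 + p) then u (n0 + p) i else 0)" for p i
  have cocycle: "A_cocycle k p ((shift ^^ (n0 - 1)) M) (Matrix.vec k (u' 0)) = Matrix.vec k (u' p)" for p
  proof (induction p)
    case (Suc p)
    let ?m = "M (Suc (n0 + p))"
    \<comment> \<open>\<open>A_map\<close> reads the entry at index 2 of its sequence, so step
      \<open>p\<close> uses the matrix with index \<open>2 + p + (n0 - 1)\<close>. As
      \<open>n0 \<ge> 1\<close>, this is \<open>Suc (n0 + p)\<close>, the matrix that leads from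
      stage \<open>n0 + p\<close> to the next.\<close>
    have "(shift ^^ p) ((shift ^^ (n0 - 1)) M) 2 = (shift ^^ (p + (n0 - 1))) M 2"
      by (simp add: funpow_add)
    also have "\<dots> = ?m" using n0 by (subst funpow_shift_apply) (auto intro!: arg_cong[of _ _ M])
    finally have "A_cocycle k (Suc p) ((shift ^^ (n0 - 1)) M) (Matrix.vec k (u' 0)) =
        pad k ?m *\<^sub>v Matrix.vec k (u' p)"
      using Suc by (simp add: A_map_def)
    also have "\<dots> = Matrix.vec k (u' (Suc p))"
    proof (rule eq_vecI)
      fix i assume "i < dim_vec (Matrix.vec k (u' (Suc p)))"
      then have i: "i < k" by simp
      have Ck: "C (n0 + p) \<le> k" using C[of "n0 + p"] n0 by (simp add: k_def)
      have "(pad k ?m *\<^sub>v Matrix.vec k (u' p)) $ i = (\<Sum>j<k. pad k ?m $$ (i, j) * u' p j)"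
        using i by (simp add: scalar_prod_def pad_def lessThan_atLeast0)
      also have "\<dots> = (\<Sum>j<C (n0 + p). pad k ?m $$ (i, j) * u' p j)"
        using Ck by (intro sum.mono_neutral_right) (auto simp: u'_def)
      also have "\<dots> = u' (Suc p) i"
        using i Ck dims[of "n0 + p"] n0 rec[of "n0 + p" i] by (auto simp: pad_def u'_def)
      finally show "(pad k ?m *\<^sub>v Matrix.vec k (u' p)) $ i = Matrix.vec k (u' (Suc p)) $ i"
        using i by simp
    qed (simp add: pad_def)
    finally show ?case .
  qed simp
  have "Matrix.vec k (u' 0) \<in> carrier_vec k" by simp
  then obtain l where l: "l \<noteq> 0"
    "(\<lambda>p. ereal (1 / real p) * log_ext (N (A_cocycle k p ((shift ^^ (n0 - 1)) M) (Matrix.vec k (u' 0))))) \<longlonglongrightarrow> l"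
    using hyp MB unfolding hyperbolic_on_def k_def by blast
  have u'0: "(\<lambda>p. u' p i) \<longlonglongrightarrow> 0" for i
  proof (rule LIMSEQ_I)
    fix r :: real assume "0 < r"
    then obtain n1 where "\<forall>n\<ge>n1. \<forall>i<C n. \<bar>u n i\<bar> \<le> r / 2" using lim[of "r/2"] by auto
    then have "\<bar>u' p i\<bar> < r" if "p \<ge> n1" for p
    proof (cases "i < C (n0 + p)")
      case True
      then have "\<bar>u (n0 + p) i\<bar> \<le> r / 2" using \<open>\<forall>n\<ge>n1. _\<close> that by simp
      then show ?thesis using True \<open>0 < r\<close> by (simp add: u'_def)
    qed (use \<open>0 < r\<close> in \<open>simp add: u'_def\<close>)
    then show "\<exists>no. \<forall>p\<ge>no. norm (u' p i - 0) < r" by auto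
  qed
  show ?thesis
  proof (rule exponential_decay_of_nonzero_exponent[OF N[folded k_def] u'0 l(2)[unfolded cocycle] l(1)])
    fix c K :: real and p0 :: nat
    assume c: "0 < c" and decay: "\<And>p i. p \<ge> p0 \<Longrightarrow> i < k \<Longrightarrow> \<bar>u' p i\<bar> \<le> K * exp (- (c * real p))"
    show thesis
    proof (rule that[OF c])
      fix n i assume n: "n \<ge> n0 + p0" and i: "i < C n"
      have "i < k" using i C[of n] n n0 by (simp add: k_def)
      then have "\<bar>u' (n - n0) i\<bar> \<le> K * exp (- (c * real (n - n0)))" using decay[of "n - n0" i] n by simp
      \<comment> \<open>Going back from the orbit index \<open>n - n0\<close> to \<open>n\<close>
        costs the constant factor \<open>exp (c * real n0)\<close>.\<close>
      also have "- (c * real (n - n0)) = c * real n0 + - (c * real n)"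
        using n by (simp add: of_nat_diff algebra_simps)
      also have "K * exp (c * real n0 + - (c * real n)) = K * exp (c * real n0) * exp (- (c * real n))"
        by (simp only: exp_add mult.assoc)
      finally show "\<bar>u n i\<bar> \<le> K * exp (c * real n0) * exp (- (c * real n))" using n i by (simp add: u'_def)
    qed
  qed
qed

lemma hyperbolic_eigenfunctions_continuous:
  assumes fin: "finite MM" and M: "M \<in> seq_space MM" "M \<in> B"
    and sys: "LR_system_associated M X T"
    and \<mu>: "borel_prob_on X \<mu>" "invariant_measure \<mu> T"
    and N: "norm_on (max_size MM) N" and hyp: "hyperbolic_on MM \<nu> N B"
  shows "all_eigenfunctions_continuous X T \<mu>"
  unfolding all_eigenfunctions_continuous_def
proof (intro allI impI)
  fix \<zeta> f assume eig: "eigenfunction T \<mu> \<zeta> f"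
  obtain C P h where P: "LR_partition_sequence X T C P h"
      "\<And>n. n \<ge> 2 \<Longrightarrow> assoc_matrix X T C P h n = M n"
    and T: "homeomorphic_map X X T"
    using sys unfolding LR_system_associated_def minimal_cantor_system_def by blast
  interpret LR_measure X T C P h \<mu>
  proof (intro LR_measure.intro LR_partitions.intro LR_measure_axioms.intro)
    show "LR_partition_sequence X T C P h" by fact
    show "T ` topspace X = topspace X" using T by (rule homeomorphic_imp_surjective_map)
    show "prob_space \<mu>" "sets \<mu> = sets (sigma (topspace X) {U. openin X U})"
      using \<mu>(1) by (auto simp: borel_prob_on_def)
    show "T \<in> measurable \<mu> \<mu>" "distr \<mu> \<mu> T = \<mu>" using \<mu>(2) by (auto simp: invariant_measure_def)
  qed
  \<comment> \<open>The sequence prescribes the associated matrices from index 2 on, whence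
    \<open>n \<ge> 1\<close>; rows and columns count from 0 and towers from 1, whence the
    successors.\<close>
  have mat: "M (Suc n) = mat (C (Suc n)) (C n) (\<lambda>(l, k). real (card (visits n (Suc l) (Suc k))))"
    if "n \<ge> 1" for n
    using P(2)[of "Suc n"] that by (simp add: assoc_matrix_def visits_def)
  obtain m0 where m0: "\<And>n l. n \<ge> m0 \<Longrightarrow> l \<in> {1..C (Suc n)} \<Longrightarrow>
      phase \<zeta> (Suc n) l = (\<Sum>k\<in>{1..C n}. card (visits n l k) * phase \<zeta> n k)"
    using phase_eventually_linear[OF eig] by blast
  define n0 where "n0 = max 1 m0"
  define u where "u n i = phase \<zeta> n (Suc i)" for n i
  show "ae_continuous_eigenfunction X T \<mu> \<zeta> f"
  proof (rule hyperbolic_decay[OF hyp N M(2), of C n0 u])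
    show "C n \<le> max_size MM" if "n \<ge> 1" for n
    proof -
      have "M (Suc n) \<in> MM" using M(1) by (auto simp: seq_space_def)
      then have "dim_col (M (Suc n)) \<le> max_size MM"
        unfolding max_size_def using fin by (intro Max_ge) auto
      then show ?thesis using mat[OF that] by simp
    qed
    show "dim_row (M (Suc n)) = C (Suc n)" "dim_col (M (Suc n)) = C n" if "n \<ge> 1" for n
      using mat[OF that] by simp_all
    show "1 \<le> n0" by (simp add: n0_def)
    show "u (Suc n) i = (\<Sum>j<C n. M (Suc n) $$ (i, j) * u n j)" if n: "n \<ge> n0" and i: "i < C (Suc n)" for n i
    proof -
      have n1: "n \<ge> 1" "n \<ge> m0" using n by (auto simp: n0_def)
      have "u (Suc n) i = (\<Sum>k\<in>{1..C n}. card (visits n (Suc i) k) * phase \<zeta> n k)"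
        unfolding u_def using i by (intro m0[OF n1(2)]) auto
      also have "\<dots> = (\<Sum>j<C n. card (visits n (Suc i) (Suc j)) * phase \<zeta> n (Suc j))"
        by (rule sum.reindex_bij_witness[of _ Suc "\<lambda>k. k - 1"]) auto
      also have "\<dots> = (\<Sum>j<C n. M (Suc n) $$ (i, j) * u n j)"
        using mat[OF n1(1)] i by (intro sum.cong) (auto simp: u_def)
      finally show ?thesis .
    qed
    show "\<exists>n1. \<forall>n\<ge>n1. \<forall>i<C n. \<bar>u n i\<bar> \<le> \<epsilon>" if "0 < \<epsilon>" for \<epsilon>
      using phase_tendsto_0[OF eig that] by (fastforce simp: u_def)
  next
    fix c K n1 assume c: "0 < c" and decay: "\<And>n i. n \<ge> n1 \<Longrightarrow> i < C n \<Longrightarrow> \<bar>u n i\<bar> \<le> K * exp (- (c * real n))"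
    show ?thesis
    proof (rule ae_continuous_of_exponential_decay[OF eig c])
      fix n l assume "n \<ge> n1" "l \<in> {1..C n}"
      moreover from this obtain i where "l = Suc i" "i < C n" by (cases l) auto
      ultimately show "\<bar>phase \<zeta> n l\<bar> \<le> K * exp (- (c * real n))" using decay[of n i] by (simp add: u_def)
    qed
  qed
qed

theorem mainTheorem4:
  fixes MM :: "real mat set"
    and \<nu> :: "(nat \<Rightarrow> real mat) measure"
    and X :: "(nat \<Rightarrow> real mat) \<Rightarrow> 'x topology"
    and T :: "(nat \<Rightarrow> real mat) \<Rightarrow> 'x \<Rightarrow> 'x"
    and \<mu> :: "(nat \<Rightarrow> real mat) \<Rightarrow> 'x measure"
    and N :: "real Matrix.vec \<Rightarrow> real"
    and B :: "(nat \<Rightarrow> real mat) set"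
  assumes "finite MM"
    and "seq_space MM \<noteq> {}"
    and "borel_prob_on (seq_topology MM) \<nu>"
    and "ergodic_measure \<nu> shift"
    and "\<And>M. M \<in> seq_space MM \<Longrightarrow> LR_system_associated M (X M) (T M)"
    and "\<And>M. M \<in> seq_space MM \<Longrightarrow> borel_prob_on (X M) (\<mu> M) \<and> invariant_measure (\<mu> M) (T M)"
    and "norm_on (max_size MM) N"
    and "hyperbolic_on MM \<nu> N B"
  shows "(\<forall>M\<in>B. all_eigenfunctions_continuous (X M) (T M) (\<mu> M)) \<and>
         (AE M in \<nu>. all_eigenfunctions_continuous (X M) (T M) (\<mu> M))"
proof
  interpret \<nu>: prob_space \<nu> using assms(3) by (simp add: borel_prob_on_def)
  have B: "B \<in> sets \<nu>" "measure \<nu> B = 1" using assms(8) by (auto simp: hyperbolic_on_def)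
  \<comment> \<open>The systems are given for sequences in \<open>seq_space MM\<close>. A set
    measurable for \<open>\<nu>\<close> lies in the space of \<open>\<nu>\<close>, so
    \<open>B\<close> consists of such sequences.\<close>
  have "{U. openin (seq_topology MM) U} \<subseteq> Pow (topspace (seq_topology MM))"
    by (auto dest: openin_subset)
  then have "space \<nu> = topspace (seq_topology MM)"
    using assms(3) sets_eq_imp_space_eq space_measure_of unfolding borel_prob_on_def by metis
  then have "B \<subseteq> seq_space MM"
    using sets.sets_into_space[OF B(1)] by (auto simp: seq_topology_def)
  then show all: "\<forall>M\<in>B. all_eigenfunctions_continuous (X M) (T M) (\<mu> M)"
    using hyperbolic_eigenfunctions_continuous[OF assms(1) _ _ assms(5) _ _ assms(7,8)] assms(6) by blast
  show "AE M in \<nu>. all_eigenfunctions_continuous (X M) (T M) (\<mu> M)"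
    using \<nu>.AE_prob_1[OF B(2)] all by auto
qed

end
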